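(* Let $M\ge3$ and let $\mu_M$ be a Kaufman measure on $F_M$, with $\eta>0$ the constant from the Fourier decay property below. Let $(a_n)_{n\ge1}$ be a sequence of real numbers and $(\psi_n)_{n\ge1}$ a sequence of non-negative numbers such that, for all positive integers $u<v$, \[ \sum_{\substack{n,m=u\\ n\neq m}}^{v} |a_n-a_m|^{-\eta} \ll \frac{1}{\log v}\sum_{n=u}^{v}\psi_n \] (with implied constant independent of $u,v$). Let $\Psi_N=\psi_1+\cdots+\psi_N$ and $\varepsilon>0$. Then for $\mu_M$-almost every $x\in[0,1]$, \[ D_N(a_nx)\ll \big(N(\log N)^2+\Psi_N\big)^{1/2}\,\log\big(N(\log N)^2+\Psi_N\big)^{3/2+\varepsilon}+\max_{n\le N}\psi_n . \]
   Context: For $\alpha\in[0,1)$ with continued fraction expansion $[a_1(\alpha),a_2(\alpha),\dots]$ and $M\ge3$, $F_M=\{\alpha\in[0,1): a_i(\alpha)\le M \text{ for all } i\}$. A Kaufman measure $\mu_M$ is a Borel probability measure supported on $F_M$ with the properties: (i) for every $s<\dim F_M$ there are $c,l>0$ with $\mu_M(I)\le c|I|^s$ for every interval $I\subseteq[0,1)$ with $|I|\le l$; (ii) there are constants $c,\eta>0$ such that the Fourier transform $\hat\mu_M(u)=\int e(-ux)\,d\mu_M(x)$ satisfies $|\hat\mu_M(u)|\le c|u|^{-\eta}$ for $u\neq0$ (such measures exist by a theorem of Kaufman). Here $e(x)=\exp(2\pi i x)$. For a sequence $(x_n)$ of reals, the discrepancy is $D_N(x_n)=\sup_{I\subseteq[0,1]}\big|\#\{n\le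 N:\{x_n\}\in I\}-N|I|\big|$, the supremum over intervals $I$, where $\{\cdot\}$ is the fractional part. $f\ll g$ means $f\le Cg$ for some constant $C>0$ (here allowed to depend on $x$). *)

theory Defs
  imports "HOL-Probability.Probability"
begin

subsection \<open>Hausdorff dimension\<close>

definition hausdorff_premeasure :: "real \<Rightarrow> real \<Rightarrow> 'a::metric_space set \<Rightarrow> ennreal" where
  "hausdorff_premeasure s \<delta> A =
     (INF U \<in> {U :: nat \<Rightarrow> 'a set. A \<subseteq> (\<Union>i. U i) \<and> (\<forall>i. bounded (U i) \<and> diameter (U i) \<le> \<delta>)}.
        \<Sum>i. ennreal (diameter (U i) powr s))"

definition hausdorff_measure :: "real \<Rightarrow> 'a::metric_space set \<Rightarrow> ennreal" where
  "hausdorff_measure s A = (SUP \<delta> \<in> {0<..}. hausdorff_premeasure s \<delta> A)"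

text \<open>
  The exponent \<open>s = 0\<close> is left out because \<open>0 powr 0 = 0\<close> in HOL; this does not change the infimum.
\<close>
definition hausdorff_dim :: "'a::metric_space set \<Rightarrow> ereal" where
  "hausdorff_dim A = (INF s \<in> {s. 0 < s \<and> hausdorff_measure s A = 0}. ereal s)"

subsection \<open>Continued fractions with bounded partial quotients\<close>

definition gauss_map :: "real \<Rightarrow> real" where
  "gauss_map x = frac (1 / x)"

text \<open>
  For \<open>\<alpha> \<in> [0,1)\<close> and \<open>i \<ge> 1\<close> this is the partial quotient \<open>a\<^sub>i(\<alpha>)\<close> of \<open>\<alpha> = [a\<^sub>1, a\<^sub>2, \<dots>]\<close>. If the
  expansion of a rational \<open>\<alpha>\<close> terminates before index \<open>i\<close>, the value is \<open>0\<close> (since \<open>1 / 0 = 0\<close>), so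
  that the missing partial quotients impose no condition in \<open>F_set\<close>.
\<close>
definition partial_quotient :: "real \<Rightarrow> nat \<Rightarrow> int" where
  "partial_quotient \<alpha> i = \<lfloor>1 / (gauss_map ^^ (i - 1)) \<alpha>\<rfloor>"

definition F_set :: "nat \<Rightarrow> real set" where
  "F_set M = {\<alpha> \<in> {0..<1}. \<forall>i\<ge>1. partial_quotient \<alpha> i \<le> int M}"

subsection \<open>Kaufman measures\<close>

definition unit_exp :: "real \<Rightarrow> complex" where
  "unit_exp x = exp (2 * complex_of_real pi * \<i> * complex_of_real x)"

definition fourier_transform :: "real measure \<Rightarrow> real \<Rightarrow> complex" where
  "fourier_transform \<mu> u = (LINT x|\<mu>. unit_exp (- u * x))"

definition fourier_decay :: "real measure \<Rightarrow> real \<Rightarrow> bool" where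
  "fourier_decay \<mu> \<eta> \<longleftrightarrow>
     (\<exists>c>0. \<forall>u. u \<noteq> 0 \<longrightarrow> norm (fourier_transform \<mu> u) \<le> c * \<bar>u\<bar> powr (- \<eta>))"

text \<open>
  In the condition on intervals only exponents \<open>s > 0\<close> appear: for \<open>s \<le> 0\<close> the bound is void
  mathematically (take \<open>c = l = 1\<close>), whereas HOL's \<open>0 powr s = 0\<close> would give it content for
  degenerate intervals.
\<close>
definition kaufman_measure :: "nat \<Rightarrow> real measure \<Rightarrow> bool" where
  "kaufman_measure M \<mu> \<longleftrightarrow>
     prob_space \<mu> \<and> sets \<mu> = sets borel \<and> (AE x in \<mu>. x \<in> F_set M) \<and>
     (\<forall>s. 0 < s \<and> ereal s < hausdorff_dim (F_set M) \<longrightarrow>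
        (\<exists>c>0. \<exists>l>0. \<forall>I. is_interval I \<and> I \<subseteq> {0..<1} \<and> measure lborel I \<le> l \<longrightarrow>
           measure \<mu> I \<le> c * measure lborel I powr s)) \<and>
     (\<exists>\<eta>>0. fourier_decay \<mu> \<eta>)"

subsection \<open>Discrepancy\<close>

text \<open>Sequences are indexed from \<open>1\<close>; the value at index \<open>0\<close> is irrelevant.\<close>
definition discrepancy :: "nat \<Rightarrow> (nat \<Rightarrow> real) \<Rightarrow> real" where
  "discrepancy N x =
     (SUP I \<in> {I. is_interval I \<and> I \<subseteq> {0..1}}.
        \<bar>real (card {n \<in> {1..N}. frac (x n) \<in> I}) - real N * measure lborel I\<bar>)"

end

theory Submission
  imports Defs
begin

text \<open>
  Comparing the indicator of an interval with a periodic trapezoid, whose Fourier coefficients are of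
  size \<open>1 / k\<close>, bounds the deviation of any finite block \<open>{u..v}\<close> by a weighted sum of the exponential
  sums \<open>\<Sum>\<^sub>n e(k a\<^sub>n x)\<close> with \<open>k \<le> v\<^sup>4\<close>. Expanding their squares and integrating against \<open>\<mu>\<close> leaves the
  diagonal and the Fourier transform at \<open>k (a\<^sub>m - a\<^sub>n)\<close>, so the block has second moment at most
  a constant times \<open>(v - u + 1) (1 + log v)\<^sup>2 + \<psi>\<^sub>u + \<dots> + \<psi>\<^sub>v\<close>. The maximal estimate over \<open>N\<close> follows by
  cutting \<open>{1..N}\<close> into dyadic blocks, and the almost sure bound by summing over the scales of
  \<open>N (log N)\<^sup>2 + \<Psi>\<^sub>N\<close>. Since the blocks stay inside
  \<open>{1..N}\<close>, no interpolation between scales is needed, and the term \<open>max \<psi>\<^sub>n\<close> does not arise.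
\<close>

subsection \<open>A Fourier approximation of the periodic parabola\<close>

text \<open>With \<open>z = y / 2\<close>, the inequality \<open>z * cos z \<le> sin z\<close> and
  the double angle formula give
  \<open>sin y \<ge> 2 * z * (cos z)\<^sup>2 = z * (1 + cos y)\<close>, and \<open>cos y\<close> is
  nonnegative on this range.\<close>

lemma sin_ge_half:
  fixes y :: real
  assumes "0 \<le> y" "y \<le> pi / 2"
  shows "y / 2 \<le> sin y"
proof -
  define z where "z = y / 2"
  have z: "0 \<le> z" "z \<le> pi / 4" and y: "y = 2 * z"
    using assms by (auto simp: z_def)
  have "(\<lambda>t. sin t - t * cos t) 0 \<le> (\<lambda>t. sin t - t * cos t) z"
  proof (rule DERIV_nonneg_imp_nondecreasing[OF z(1)])
    fix t assume t: "0 \<le> t" "t \<le> z"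
    have "((\<lambda>t. sin t - t * cos t) has_real_derivative t * sin t) (at t)"
      by (auto intro!: derivative_eq_intros)
    moreover have "0 \<le> t * sin t"
      using t z pi_gt_zero by (intro mult_nonneg_nonneg sin_ge_zero) auto
    ultimately show "\<exists>y. ((\<lambda>t. sin t - t * cos t) has_real_derivative y) (at t) \<and> 0 \<le> y"
      by blast
  qed
  then have "z * cos z \<le> sin z" by simp
  moreover have c: "0 \<le> cos z" using z by (intro cos_ge_zero) auto
  ultimately have "2 * (z * cos z) * cos z \<le> 2 * sin z * cos z"
    by (intro mult_right_mono) auto
  moreover have "2 * (z * cos z) * cos z = z * (cos y + 1)"
    unfolding y cos_double_cos by (simp add: power2_eq_square algebra_simps)
  moreover have "0 \<le> z * cos y"
    using z assms by (intro mult_nonneg_nonneg cos_ge_zero) auto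
  ultimately show ?thesis
    unfolding y sin_double by (simp add: algebra_simps)
qed

section \<open>Truncated Fourier series of the sawtooth\<close>

lemma dirichlet_kernel:
  "sin (pi * x) * (1 + 2 * (\<Sum>k=1..n. cos (2 * pi * real k * x))) = sin ((2 * real n + 1) * pi * x)"
proof (induction n)
  case (Suc n)
  define z where "z = 2 * pi * real (Suc n) * x"
  have 1: "(2 * real (Suc n) + 1) * pi * x = z + pi * x" "(2 * real n + 1) * pi * x = z - pi * x"
    by (simp_all add: z_def algebra_simps)
  have "sin (pi * x) * (1 + 2 * (\<Sum>k=1..Suc n. cos (2 * pi * real k * x)))
      = sin (z - pi * x) + 2 * sin (pi * x) * cos z"
    using Suc unfolding 1 by (simp add: z_def algebra_simps)
  also have "\<dots> = sin (z + pi * x)"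
    by (simp add: sin_add sin_diff)
  finally show ?case unfolding 1 .
qed simp

text \<open>The remainder of the Fourier series of \<open>1 / 2 - x\<close> on the open unit
  interval. Its derivative is minus the Dirichlet kernel.\<close>

definition sawtooth_err :: "nat \<Rightarrow> real \<Rightarrow> real" where
  "sawtooth_err n x = 1 / 2 - x - (\<Sum>k=1..n. sin (2 * pi * real k * x) / (pi * real k))"

lemma sawtooth_err_deriv:
  "(sawtooth_err n has_real_derivative - (1 + 2 * (\<Sum>k=1..n. cos (2 * pi * real k * x)))) (at x)"
  unfolding sawtooth_err_def[abs_def]
  by (auto intro!: derivative_eq_intros sum.cong simp: sum_distrib_left mult_ac)

lemma sawtooth_err_half: "sawtooth_err n (1 / 2) = 0"
proof -
  have "(\<Sum>k=1..n. sin (2 * pi * real k * (1 / 2)) / (pi * real k)) = 0"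
    by (intro sum.neutral) (auto simp: mult.commute[of pi])
  then show ?thesis by (simp add: sawtooth_err_def)
qed

text \<open>The derivative is \<open>- sin (m * x) / sin (pi * x)\<close> with \<open>m\<close> of
  order \<open>n\<close>. One integration by parts against the fast oscillation gains the factor
  \<open>1 / m\<close>; the integral starts at 1/2, where the remainder vanishes.\<close>

lemma sawtooth_err_bound:
  assumes x: "0 < x" "x \<le> 1 / 2" and n: "n \<ge> 1"
  shows "\<bar>sawtooth_err n x\<bar> \<le> 1 / (real n * x)"
proof -
  define m where "m = (2 * real n + 1) * pi"
  have m: "m > 0" by (simp add: m_def add_pos_pos)
  \<comment> \<open>The subtracted quotient is the boundary term of the integration by parts, so the
    derivative of \<open>U\<close> already carries the factor \<open>1 / m\<close>.\<close>
  define U where "U = (\<lambda>x. sawtooth_err n x - cos (m * x) / (m * sin (pi * x)))"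
  have sp: "sin (pi * t) > 0" if "0 < t" "t \<le> 1 / 2" for t
    using that pi_gt_zero by (intro sin_gt_zero) (auto simp: field_simps)
  have dU: "(U has_real_derivative pi * cos (m * t) * cos (pi * t) / (m * (sin (pi * t))\<^sup>2)) (at t)"
    if t: "0 < t" "t \<le> 1 / 2" for t
  proof -
    define D where "D = 1 + 2 * (\<Sum>k=1..n. cos (2 * pi * real k * t))"
    have D: "sin (pi * t) * D = sin (m * t)"
      unfolding D_def m_def by (rule dirichlet_kernel)
    have ne: "sin (pi * t) \<noteq> 0" using sp[OF t] by simp
    have "(U has_real_derivative - D - ((- sin (m * t) * m) * (m * sin (pi * t)) -
       cos (m * t) * (m * (cos (pi * t) * pi))) / (m * sin (pi * t) * (m * sin (pi * t)))) (at t)"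
      unfolding U_def D_def
      by (rule derivative_eq_intros sawtooth_err_deriv refl | use ne m in simp)+
    moreover have "- D - ((- sin (m * t) * m) * (m * sin (pi * t)) -
       cos (m * t) * (m * (cos (pi * t) * pi))) / (m * sin (pi * t) * (m * sin (pi * t)))
       = pi * cos (m * t) * cos (pi * t) / (m * (sin (pi * t))\<^sup>2)"
      unfolding D[symmetric] using ne m by (simp add: field_simps power2_eq_square)
    ultimately show ?thesis by simp
  qed
  \<comment> \<open>Replacing both cosines in the derivative of \<open>U\<close> by 1 gives the
    derivative of \<open>- cot (pi * t) / m\<close>, which therefore serves as a majorant.\<close>
  have dcot: "((\<lambda>t. - (cos (pi * t) / (m * sin (pi * t)))) has_real_derivative pi / (m * (sin (pi * t))\<^sup>2)) (at t)"
    if t: "0 < t" "t \<le> 1 / 2" for t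
  proof -
    have ne: "sin (pi * t) \<noteq> 0" using sp[OF t] by simp
    have "((\<lambda>t. - (cos (pi * t) / (m * sin (pi * t)))) has_real_derivative
      - (((- sin (pi * t) * pi) * (m * sin (pi * t)) - cos (pi * t) * (m * (cos (pi * t) * pi)))
        / (m * sin (pi * t) * (m * sin (pi * t))))) (at t)"
      by (rule derivative_eq_intros refl | use ne m in simp)+
    moreover have "- (((- s * pi) * (m * s) - c * (m * (c * pi))) / (m * s * (m * s)))
        = pi * (s\<^sup>2 + c\<^sup>2) / (m * s\<^sup>2)" if "s \<noteq> 0" for s c :: real
      using that m by (simp add: field_simps power2_eq_square)
    from this[OF ne, of "cos (pi * t)"]
    have "- (((- sin (pi * t) * pi) * (m * sin (pi * t)) - cos (pi * t) * (m * (cos (pi * t) * pi)))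
        / (m * sin (pi * t) * (m * sin (pi * t)))) = pi / (m * (sin (pi * t))\<^sup>2)"
      by (simp only: sin_cos_squared_add mult_1_right)
    ultimately show ?thesis by simp
  qed
  \<comment> \<open>The number \<open>m / 2\<close> is an odd multiple of \<open>pi / 2\<close>, so
    the boundary term vanishes at 1/2 as well.\<close>
  have Uh: "U (1 / 2) = 0"
  proof -
    have "cos (m * (1 / 2)) = 0"
    proof -
      have "m * (1 / 2) = real n * pi + pi / 2" by (simp add: m_def algebra_simps)
      then show ?thesis by (simp only: cos_add) simp
    qed
    then show ?thesis by (simp add: U_def sawtooth_err_half)
  qed
  have Ux: "\<bar>U x\<bar> \<le> cos (pi * x) / (m * sin (pi * x))"
  proof (cases "x = 1 / 2")
    case True
    show ?thesis unfolding True by (simp add: Uh)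
  next
    case False
    then have x': "x < 1 / 2" using x by simp
    have "norm (U (1 / 2) - U x)
       \<le> - (cos (pi * (1 / 2)) / (m * sin (pi * (1 / 2)))) - (- (cos (pi * x) / (m * sin (pi * x))))"
    proof (rule differentiable_bound_general[OF x'])
      show "continuous_on {x..1/2} U"
        by (rule DERIV_continuous_on, rule has_field_derivative_at_within, rule dU, use x in auto)
      show "continuous_on {x..1/2} (\<lambda>t. - (cos (pi * t) / (m * sin (pi * t))))"
        by (rule DERIV_continuous_on, rule has_field_derivative_at_within, rule dcot, use x in auto)
      fix t assume t: "x < t" "t < 1 / 2"
      then have t': "0 < t" "t \<le> 1 / 2" using x by auto
      show "(U has_vector_derivative pi * cos (m * t) * cos (pi * t) / (m * (sin (pi * t))\<^sup>2)) (at t)"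
        using dU[OF t'] by (simp add: has_real_derivative_iff_has_vector_derivative)
      show "((\<lambda>t. - (cos (pi * t) / (m * sin (pi * t)))) has_vector_derivative pi / (m * (sin (pi * t))\<^sup>2)) (at t)"
        using dcot[OF t'] by (simp add: has_real_derivative_iff_has_vector_derivative)
      have "\<bar>cos (m * t)\<bar> * \<bar>cos (pi * t)\<bar> \<le> 1 * 1"
        by (intro mult_mono) auto
      then have "\<bar>pi * cos (m * t) * cos (pi * t)\<bar> \<le> pi"
        by (simp add: abs_mult mult.assoc)
      then show "norm (pi * cos (m * t) * cos (pi * t) / (m * (sin (pi * t))\<^sup>2)) \<le> pi / (m * (sin (pi * t))\<^sup>2)"
        using m by (simp add: abs_divide divide_right_mono)
    qed
    then show ?thesis using Uh by simp
  qed
  have s: "pi * x / 2 \<le> sin (pi * x)"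
    using x pi_gt_zero by (intro sin_ge_half) (auto simp: field_simps)
  have sx: "sin (pi * x) > 0" using sp x by auto
  have "\<bar>p\<bar> \<le> \<bar>p - q\<bar> + \<bar>q\<bar>" for p q :: real by linarith
  then have "\<bar>sawtooth_err n x\<bar> \<le> \<bar>U x\<bar> + \<bar>cos (m * x) / (m * sin (pi * x))\<bar>"
    unfolding U_def .
  also have "\<dots> \<le> 1 / (m * sin (pi * x)) + 1 / (m * sin (pi * x))"
  proof (intro add_mono order.trans[OF Ux])
    show "cos (pi * x) / (m * sin (pi * x)) \<le> 1 / (m * sin (pi * x))"
      using m sx by (intro divide_right_mono) auto
    show "\<bar>cos (m * x) / (m * sin (pi * x))\<bar> \<le> 1 / (m * sin (pi * x))"
      using m sx by (simp add: abs_divide abs_mult divide_right_mono)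
  qed
  also have "\<dots> = 2 / (m * sin (pi * x))" by simp
  also have "\<dots> \<le> 2 / (m * (pi * x / 2))"
    using m s x sx by (intro divide_left_mono mult_left_mono mult_pos_pos) auto
  \<comment> \<open>The two boundary contributions and the factor 2 lost in
    \<open>sin_ge_half\<close> make 4 in total, which \<open>pi * pi\<close> absorbs.\<close>
  also have "\<dots> \<le> 1 / (real n * x)"
  proof -
    have "2 * 2 \<le> pi * pi" using pi_gt3 by (intro mult_mono) auto
    then have "4 * real n \<le> (pi * pi) * (2 * real n + 1)"
      by (intro mult_mono) auto
    then have "4 * real n * x \<le> (pi * pi) * (2 * real n + 1) * x"
      using x by (intro mult_right_mono) auto
    then have "2 * (real n * x) \<le> m * (pi * x / 2)"
      by (simp add: m_def algebra_simps)
    then have "2 / (m * (pi * x / 2)) \<le> 2 / (2 * (real n * x))"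
      using x n m by (intro divide_left_mono) auto
    then show ?thesis by simp
  qed
  finally show ?thesis .
qed

section \<open>Integrating the sawtooth remainder to a parabola\<close>

definition parabola_err :: "nat \<Rightarrow> real \<Rightarrow> real" where
  "parabola_err n x = (x - x\<^sup>2) / 2 + (\<Sum>k=1..n. cos (2 * pi * real k * x) / (2 * pi\<^sup>2 * (real k)\<^sup>2))"

lemma parabola_err_deriv: "(parabola_err n has_real_derivative sawtooth_err n x) (at x)"
proof -
  have "(parabola_err n has_real_derivative ((1 - 2 * x) / 2 +
     (\<Sum>k=1..n. (- sin (2 * pi * real k * x) * (2 * pi * real k)) / (2 * pi\<^sup>2 * (real k)\<^sup>2)))) (at x)"
    unfolding parabola_err_def[abs_def]
    by (auto intro!: derivative_eq_intros sum.cong)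
  also have "(1 - 2 * x) / 2 +
     (\<Sum>k=1..n. (- sin (2 * pi * real k * x) * (2 * pi * real k)) / (2 * pi\<^sup>2 * (real k)\<^sup>2)) = sawtooth_err n x"
    unfolding sawtooth_err_def
    by (simp add: diff_conv_add_uminus sum_negf[symmetric] del: add_uminus_conv_diff)
       (auto intro!: sum.cong simp: field_simps power2_eq_square)
  finally show ?thesis .
qed

text \<open>Integrate \<open>sawtooth_err\<close>: beyond \<open>1 / n\<close> the bound
  \<open>1 / (n * t)\<close> contributes about \<open>ln n / n\<close>, and on
  \<open>[0, 1 / n]\<close> a uniform bound by 3 suffices. Comparing with the value at 1/2 avoids
  evaluating the sum of \<open>1 / k\<^sup>2\<close>. The rate \<open>1 / sqrt n\<close> is enough
  because \<open>n\<close> will be a fourth power.\<close>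

lemma parabola_err_bound_half:
  assumes x: "0 \<le> x" "x \<le> 1 / 2" and n: "n \<ge> 1"
  shows "\<bar>parabola_err n x - parabola_err n (1 / 2)\<bar> \<le> 4 / sqrt (real n)"
proof -
  have cont: "continuous_on S (parabola_err n)" for S
    by (rule DERIV_continuous_on, rule has_field_derivative_at_within, rule parabola_err_deriv)
  have sn: "1 \<le> sqrt (real n)" "sqrt (real n) * sqrt (real n) = real n"
    using n by auto
  have A: "\<bar>parabola_err n y - parabola_err n (1 / 2)\<bar> \<le> 1 / sqrt (real n)"
    if y: "1 / real n \<le> y" "y \<le> 1 / 2" for y
  proof (cases "y = 1 / 2")
    case False
    then have y': "y < 1 / 2" using y by simp
    have y0: "0 < y" using y(1) n by (auto intro: less_le_trans[of 0 "1 / real n" y])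
    have "norm (parabola_err n (1 / 2) - parabola_err n y) \<le> ln (1 / 2) / real n - ln y / real n"
    proof (rule differentiable_bound_general[OF y' cont])
      show "continuous_on {y..1 / 2} (\<lambda>t. ln t / real n)"
        using y0 n by (intro continuous_intros) auto
      fix t assume t: "y < t" "t < 1 / 2"
      show "(parabola_err n has_vector_derivative sawtooth_err n t) (at t)"
        using parabola_err_deriv[of n t] by (simp add: has_real_derivative_iff_has_vector_derivative)
      have "((\<lambda>t. ln t / real n) has_real_derivative 1 / (real n * t)) (at t)"
        using t y0 n by (auto intro!: derivative_eq_intros simp: field_simps)
      then show "((\<lambda>t. ln t / real n) has_vector_derivative 1 / (real n * t)) (at t)"
        by (simp add: has_real_derivative_iff_has_vector_derivative)
      show "norm (sawtooth_err n t) \<le> 1 / (real n * t)"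
        using sawtooth_err_bound[of t n] t y0 n by simp
    qed
    also have "ln (1 / 2) / real n - ln y / real n = ln (1 / (2 * y)) / real n"
      using y0 by (simp add: ln_div ln_mult diff_divide_distrib)
    also have "\<dots> \<le> ln (real n / 2) / real n"
    proof -
      have "1 / (2 * y) \<le> real n / 2"
        using y y0 n by (simp add: field_simps)
      then show ?thesis using y0 n by (intro divide_right_mono) (auto simp: ln_le_cancel_iff)
    qed
    also have "\<dots> \<le> 1 / sqrt (real n)"
    proof -
      \<comment> \<open>Applying \<open>ln t \<le> t - 1\<close> at \<open>t = sqrt n / 2\<close>
        bounds the logarithm by \<open>sqrt n\<close>.\<close>
      have "ln (real n / 2) = ln ((sqrt (real n))\<^sup>2) - ln 2"
        using n by (simp add: ln_div)
      also have "\<dots> = 2 * ln (sqrt (real n)) - ln 2"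
        using sn by (subst ln_realpow) auto
      also have "ln (sqrt (real n)) = ln (sqrt (real n) / 2) + ln 2"
        using sn(1) by (subst ln_div) auto
      also have "ln (sqrt (real n) / 2) \<le> sqrt (real n) / 2 - 1"
        using sn by (intro ln_le_minus_one) auto
      finally have "ln (real n / 2) \<le> sqrt (real n)"
        using ln2_le_25_over_36 by simp
      then have "ln (real n / 2) / real n \<le> sqrt (real n) / real n"
        by (intro divide_right_mono) auto
      also have "sqrt (real n) / real n = 1 / sqrt (real n)"
        using sn n by (simp add: field_simps)
      finally show ?thesis .
    qed
    finally show ?thesis by (simp add: abs_minus_commute)
  next
    case True
    show ?thesis unfolding True by simp
  qed
  \<comment> \<open>For \<open>t \<le> 1 / n\<close> each of the \<open>n\<close> sine terms is at
    most \<open>2 * t\<close>, so the whole sum is at most 2 and the remainder at most 3.\<close>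
  have B: "\<bar>parabola_err n b - parabola_err n y\<bar> \<le> 3 * b"
    if y: "0 \<le> y" "y \<le> b" "b \<le> 1 / real n" "b \<le> 1 / 2" for y b
  proof -
    have "norm (parabola_err n b - parabola_err n y) \<le> 3 * norm (b - y)"
    proof (rule field_differentiable_bound[where S = "{y..b}" and f' = "sawtooth_err n"])
      fix t assume t: "t \<in> {y..b}"
      show "(parabola_err n has_field_derivative sawtooth_err n t) (at t within {y..b})"
        using parabola_err_deriv by (rule has_field_derivative_at_within)
      have tn: "t \<le> 1 / real n" by (rule order.trans[OF _ y(3)]) (use t in auto)
      have "\<bar>\<Sum>k=1..n. sin (2 * pi * real k * t) / (pi * real k)\<bar> \<le> (\<Sum>k=1..n. 2 * t)"
      proof (rule order.trans[OF sum_abs], rule sum_mono)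
        fix k assume k: "k \<in> {1..n}"
        have "\<bar>sin (2 * pi * real k * t)\<bar> \<le> \<bar>2 * pi * real k * t\<bar>" by (rule abs_sin_x_le_abs_x)
        also have "\<dots> = 2 * t * (pi * real k)" using t y by simp
        finally show "\<bar>sin (2 * pi * real k * t) / (pi * real k)\<bar> \<le> 2 * t"
          using k by (simp add: abs_divide abs_mult divide_le_eq)
      qed
      also have "\<dots> = 2 * (real n * t)" by simp
      also have "real n * t \<le> 1" using tn n by (simp add: field_simps)
      finally show "norm (sawtooth_err n t) \<le> 3"
        unfolding sawtooth_err_def using t y by auto
    qed (use y in auto)
    then show ?thesis using y by simp
  qed
  have "sqrt (real n) * 1 \<le> sqrt (real n) * sqrt (real n)"
    using sn(1) by (intro mult_left_mono) auto
  then have n1: "1 / real n \<le> 1 / sqrt (real n)"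
    using sn n by (intro divide_left_mono) auto
  \<comment> \<open>For \<open>n = 1\<close> the cut at \<open>1 / n\<close> would lie beyond 1/2,
    hence the minimum.\<close>
  define b where "b = min (1 / 2) (1 / real n)"
  show ?thesis
  proof (cases "x \<le> b")
    case True
    have "\<bar>parabola_err n b - parabola_err n x\<bar> \<le> 3 * b"
      using True x by (intro B) (auto simp: b_def)
    moreover have "3 * b \<le> 3 * (1 / sqrt (real n))" using n1 by (auto simp: b_def min_def)
    moreover have "\<bar>parabola_err n b - parabola_err n (1 / 2)\<bar> \<le> 1 / sqrt (real n)"
      using A[of b] by (cases "1 / real n \<le> 1 / 2") (auto simp: b_def min_def)
    ultimately show ?thesis by simp
  next
    case False
    then have "\<bar>parabola_err n x - parabola_err n (1 / 2)\<bar> \<le> 1 / sqrt (real n)"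
      using x by (intro A) (auto simp: b_def min_def split: if_splits)
    also have "\<dots> \<le> 4 / sqrt (real n)" by (intro divide_right_mono) auto
    finally show ?thesis .
  qed
qed

text \<open>Up to scale and an additive constant this is the periodic second Bernoulli function. The
  sign is opposite to that of the parabola in \<open>parabola_err\<close>, so that the cosine sum
  approximates it up to a constant.\<close>

definition frac_parabola :: "real \<Rightarrow> real" where
  "frac_parabola x = ((frac x)\<^sup>2 - frac x) / 2"

lemma cos_two_pi_frac: "cos (2 * pi * real k * frac x) = cos (2 * pi * real k * x)"
proof -
  have "2 * pi * real k * frac x = 2 * pi * real k * x - 2 * pi * of_int (int k * \<lfloor>x\<rfloor>)"
    by (simp add: frac_def algebra_simps)
  then show ?thesis by (simp only: cos_diff cos_int_2pin sin_int_2pin)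
qed

lemma frac_parabola_approx:
  assumes n: "n \<ge> 1"
  shows "\<bar>(\<Sum>k=1..n. cos (2 * pi * real k * x) / (2 * pi\<^sup>2 * (real k)\<^sup>2)) - parabola_err n (1 / 2)
     - frac_parabola x\<bar> \<le> 4 / sqrt (real n)"
proof -
  \<comment> \<open>Both sides are invariant under \<open>x\<close> to \<open>1 - x\<close>, which
    brings the fractional part into \<open>[0, 1 / 2]\<close>.\<close>
  define t where "t = (if frac x \<le> 1 / 2 then frac x else 1 - frac x)"
  have t: "0 \<le> t" "t \<le> 1 / 2"
    using frac_lt_1[of x] by (auto simp: t_def)
  have c: "cos (2 * pi * real k * t) = cos (2 * pi * real k * x)" for k
  proof (cases "frac x \<le> 1 / 2")
    case False
    have "2 * pi * real k * t = 2 * pi * of_int (int k) - 2 * pi * real k * frac x"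
      using False by (simp add: t_def algebra_simps)
    then have "cos (2 * pi * real k * t) = cos (2 * pi * real k * frac x)"
      by (simp only: cos_diff cos_int_2pin sin_int_2pin)
    then show ?thesis by (simp add: cos_two_pi_frac)
  qed (simp add: t_def cos_two_pi_frac)
  have "(t - t\<^sup>2) / 2 = - frac_parabola x"
    by (auto simp: t_def frac_parabola_def power2_eq_square field_simps)
  then have "parabola_err n t = (\<Sum>k=1..n. cos (2 * pi * real k * x) / (2 * pi\<^sup>2 * (real k)\<^sup>2)) - frac_parabola x"
    unfolding parabola_err_def c by simp
  then show ?thesis using parabola_err_bound_half[OF t n] by (simp add: algebra_simps)
qed

subsection \<open>An Erdos--Turan type inequality\<close>

lemma unit_exp_eq_cis: "unit_exp x = cis (2 * pi * x)"
  by (simp add: unit_exp_def cis_conv_exp mult_ac)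

lemma unit_exp_add: "unit_exp (x + y) = unit_exp x * unit_exp y"
  by (simp add: unit_exp_eq_cis cis_mult distrib_left)

lemma norm_unit_exp [simp]: "norm (unit_exp x) = 1"
  by (simp add: unit_exp_eq_cis)

lemma norm_unit_exp_diff_le: "norm (unit_exp x - unit_exp y) \<le> 2 * pi * \<bar>x - y\<bar>"
proof -
  have "unit_exp x - unit_exp y = unit_exp y * (unit_exp (x - y) - 1)"
    using unit_exp_add[of y "x - y"] by (simp add: algebra_simps)
  then have "norm (unit_exp x - unit_exp y) = norm (exp (\<i> * of_real (2 * pi * (x - y))) - 1)"
    by (simp add: norm_mult unit_exp_eq_cis[of "x - y"] cis_conv_exp)
  also have "\<dots> = 2 * \<bar>sin (2 * pi * (x - y) / 2)\<bar>"
    by (rule dist_exp_i_1)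
  also have "\<dots> \<le> 2 * \<bar>2 * pi * (x - y) / 2\<bar>"
    by (intro mult_left_mono abs_sin_x_le_abs_x) auto
  finally show ?thesis by (simp add: abs_mult)
qed

section \<open>Trapezoidal majorants of intervals\<close>

lemma frac_parabola_shift:
  assumes s: "0 \<le> s" "s \<le> 1"
  shows "frac_parabola (z - s) = ((frac z - s)\<^sup>2 - (frac z - s)) / 2 + min 0 (frac z - s)"
\<comment> \<open>If the shift crosses an integer, the fractional part is \<open>w + 1\<close> with
  \<open>w = frac z - s < 0\<close>. Passing from \<open>w\<close> to \<open>w + 1\<close> changes
  \<open>(w\<^sup>2 - w) / 2\<close> by exactly \<open>w\<close>, which is the minimum in the
  statement.\<close>
proof (cases "frac z < s")
  case True
  have "z - s - (frac z - s + 1) \<in> \<int>" by (simp add: frac_def)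
  moreover have "0 \<le> frac z - s + 1" using s frac_ge_0[of z] by linarith
  ultimately have eq: "frac (z - s) = frac z - s + 1"
    using True by (simp add: frac_unique_iff)
  show ?thesis
    unfolding frac_parabola_def eq using True by (simp add: power2_eq_square field_simps)
next
  case False
  have "z - s - (frac z - s) \<in> \<int>" by (simp add: frac_def)
  moreover have "frac z - s < 1" using s frac_lt_1[of z] by linarith
  ultimately have eq: "frac (z - s) = frac z - s"
    using False by (simp add: frac_unique_iff)
  show ?thesis
    unfolding frac_parabola_def eq using False by simp
qed

text \<open>The right-hand side is a periodic trapezoid: second differences of a parabola are constant, so
  only the kinks of \<open>frac_parabola\<close> at the integers contribute.\<close>

lemma indicator_le_trapezoid:
  fixes x a b \<delta> :: real
  assumes \<delta>: "0 < \<delta>" and ab: "0 \<le> a" "a \<le> b" "b - a + 2 * \<delta> \<le> 1"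
  defines "z \<equiv> x - a + \<delta>" and "t \<equiv> b - a + \<delta>"
  shows "indicator {a..b} (frac x) \<le> t + (frac_parabola (z - t) - frac_parabola (z - t - \<delta>)
           - frac_parabola z + frac_parabola (z - \<delta>)) / \<delta>"
proof -
  define \<alpha> where "\<alpha> = frac z"
  have \<alpha>: "0 \<le> \<alpha>" "\<alpha> < 1" by (auto simp: \<alpha>_def frac_lt_1)
  define m where "m = (\<lambda>y::real. min 0 y)"
  have t: "\<delta> \<le> t" "t + \<delta> \<le> 1" using \<delta> ab by (auto simp: t_def)
  have P: "frac_parabola (z - s) = ((\<alpha> - s)\<^sup>2 - (\<alpha> - s)) / 2 + m (\<alpha> - s)" if "0 \<le> s" "s \<le> 1" for s
    unfolding \<alpha>_def m_def by (rule frac_parabola_shift[OF that])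
  have P1: "frac_parabola z = ((\<alpha>)\<^sup>2 - (\<alpha>)) / 2"
    by (simp add: frac_parabola_def \<alpha>_def)
  \<comment> \<open>The quadratic parts cancel to the constant \<open>- t * \<delta>\<close>. The
    remaining terms in \<open>m\<close> form a trapezoid in \<open>\<alpha>\<close>: it rises on
    \<open>[0, \<delta>]\<close>, equals \<open>\<delta>\<close> up to \<open>t\<close>, falls to 0
    at \<open>t + \<delta>\<close> and stays 0.\<close>
  have "frac_parabola (z - t) - frac_parabola (z - t - \<delta>) - frac_parabola z + frac_parabola (z - \<delta>)
     = m (\<alpha> - t) - m (\<alpha> - t - \<delta>) + m (\<alpha> - \<delta>) - t * \<delta>"
    using P[of t] P[of "t + \<delta>"] P[of \<delta>] P1 t \<delta> 
    by (simp add: power2_eq_square field_simps)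
  then have eq: "t + (frac_parabola (z - t) - frac_parabola (z - t - \<delta>)
           - frac_parabola z + frac_parabola (z - \<delta>)) / \<delta>
     = (m (\<alpha> - t) - m (\<alpha> - t - \<delta>) + m (\<alpha> - \<delta>)) / \<delta>"
    using \<delta> by (simp add: field_simps)
  show ?thesis
  proof (cases "frac x \<in> {a..b}")
    case True
    have "frac z = frac x - a + \<delta>"
      by (rule frac_unique_iff[THEN iffD2]) (use True ab \<delta> in \<open>auto simp: frac_def z_def\<close>)
    then have "\<alpha> = frac x - a + \<delta>" by (simp add: \<alpha>_def)
    then have "m (\<alpha> - t) - m (\<alpha> - t - \<delta>) + m (\<alpha> - \<delta>) = \<delta>"
      using True \<delta> by (auto simp: m_def t_def)
    then show ?thesis unfolding eq using \<delta> by (simp add: indicator_def)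
  next
    case False
    have "0 \<le> m (\<alpha> - t) - m (\<alpha> - t - \<delta>) + m (\<alpha> - \<delta>)"
      using \<alpha> t \<delta> by (auto simp: m_def min_def)
    then show ?thesis unfolding eq using False \<delta> by simp
  qed
qed

lemma Re_unit_exp: "Re (unit_exp x) = cos (2 * pi * x)"
  by (simp add: unit_exp_eq_cis)

text \<open>The two phases factor out of the exponential sum. Their difference supplies the factor
  \<open>k * \<bar>c - d\<bar>\<close>, which turns the Fourier weights \<open>1 / k\<^sup>2\<close>
  into \<open>1 / k\<close>.\<close>

lemma sum_cos_diff_le:
  "\<bar>\<Sum>n\<in>B. cos (2 * pi * real k * (y n + c)) - cos (2 * pi * real k * (y n + d))\<bar>
    \<le> 2 * pi * real k * \<bar>c - d\<bar> * norm (\<Sum>n\<in>B. unit_exp (real k * y n))"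
proof -
  have "(\<Sum>n\<in>B. cos (2 * pi * real k * (y n + c)) - cos (2 * pi * real k * (y n + d)))
    = Re (\<Sum>n\<in>B. unit_exp (real k * y n + real k * c) - unit_exp (real k * y n + real k * d))"
    by (simp add: Re_unit_exp algebra_simps)
  also have "(\<Sum>n\<in>B. unit_exp (real k * y n + real k * c) - unit_exp (real k * y n + real k * d))
    = (\<Sum>n\<in>B. unit_exp (real k * y n)) * (unit_exp (real k * c) - unit_exp (real k * d))"
    by (simp only: unit_exp_add right_diff_distrib sum_distrib_right sum_subtractf)
  finally have "\<bar>\<Sum>n\<in>B. cos (2 * pi * real k * (y n + c)) - cos (2 * pi * real k * (y n + d))\<bar>
     \<le> norm ((\<Sum>n\<in>B. unit_exp (real k * y n)) * (unit_exp (real k * c) - unit_exp (real k * d)))"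
    by (simp only: abs_Re_le_cmod)
  also have "\<dots> \<le> norm (\<Sum>n\<in>B. unit_exp (real k * y n)) * (2 * pi * \<bar>real k * c - real k * d\<bar>)"
    unfolding norm_mult by (intro mult_left_mono norm_unit_exp_diff_le) auto
  also have "\<bar>real k * c - real k * d\<bar> = real k * \<bar>c - d\<bar>"
    by (metis abs_mult abs_of_nat right_diff_distrib')
  finally show ?thesis by (simp add: mult_ac)
qed

lemma count_closed_interval_le:
  assumes "finite B" and K: "K \<ge> 1" and ab: "0 \<le> a" "a \<le> b"
  shows "real (card {n\<in>B. frac (y n) \<in> {a..b}}) - real (card B) * (b - a)
    \<le> 18 * real (card B) / real K + (\<Sum>k=1..K^4. norm (\<Sum>n\<in>B. unit_exp (real k * y n)) / real k)"
proof -
  \<comment> \<open>The slopes of the trapezoid have width \<open>1 / K\<close>. With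
    \<open>K^4\<close> frequencies the truncation error is \<open>4 * \<delta>\<^sup>2\<close>,
    still of order \<open>\<delta>\<close> after the division by \<open>\<delta>\<close>.\<close>
  define \<delta> where "\<delta> = 1 / real K"
  have \<delta>: "\<delta> > 0" using K by (simp add: \<delta>_def)
  define E where "E = (\<Sum>k=1..K^4. norm (\<Sum>n\<in>B. unit_exp (real k * y n)) / real k)"
  have E: "E \<ge> 0" unfolding E_def by (intro sum_nonneg) auto
  show ?thesis
  proof (cases "b - a + 2 * \<delta> \<le> 1")
    \<comment> \<open>The trapezoid does not fit into one period, but then the interval is so long
      that counting all of \<open>B\<close> is good enough.\<close>
    case False
    have "real (card {n\<in>B. frac (y n) \<in> {a..b}}) \<le> real (card B) * 1"
      using assms(1) by (simp add: card_mono)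
    also have "\<dots> \<le> real (card B) * (b - a + 18 * \<delta>)"
      using False \<delta> by (intro mult_left_mono) auto
    finally show ?thesis
      unfolding E_def[symmetric] using E by (simp add: \<delta>_def algebra_simps)
  next
    case True
    define t where "t = b - a + \<delta>"
    define z where "z = (\<lambda>n. y n - a + \<delta>)"
    define S where "S = (\<lambda>x. (\<Sum>k=1..K^4. cos (2 * pi * real k * x) / (2 * pi\<^sup>2 * (real k)\<^sup>2)))"
    define e where "e = 4 * \<delta>\<^sup>2"
    define p where "p = parabola_err (K^4) (1 / 2)"
    have S: "\<bar>S x - p - frac_parabola x\<bar> \<le> e" for x
    proof -
      have "sqrt (real (K ^ 4)) = (real K)\<^sup>2"
        by (rule real_sqrt_unique) auto
      then show ?thesis
        using frac_parabola_approx[of "K^4" x] K by (simp add: S_def p_def e_def \<delta>_def power_divide)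
    qed
    have "real (card {n\<in>B. frac (y n) \<in> {a..b}}) = (\<Sum>n\<in>B. indicator {a..b} (frac (y n)))"
      using assms(1) by (simp add: indicator_def sum.If_cases Int_def)
    also have "\<dots> \<le> (\<Sum>n\<in>B. t + 4 * e / \<delta> + ((S (z n - t) - S (z n - t - \<delta>)) + (S (z n - \<delta>) - S (z n))) / \<delta>)"
    proof (rule sum_mono)
      fix n
      have "frac_parabola (z n - t) - frac_parabola (z n - t - \<delta>) - frac_parabola (z n) + frac_parabola (z n - \<delta>)
        \<le> 4 * e + ((S (z n - t) - S (z n - t - \<delta>)) + (S (z n - \<delta>) - S (z n)))"
        using S[of "z n - t"] S[of "z n - t - \<delta>"] S[of "z n"] S[of "z n - \<delta>"] by linarith
      then have "(frac_parabola (z n - t) - frac_parabola (z n - t - \<delta>) - frac_parabola (z n) + frac_parabola (z n - \<delta>)) / \<delta>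
        \<le> (4 * e + ((S (z n - t) - S (z n - t - \<delta>)) + (S (z n - \<delta>) - S (z n)))) / \<delta>"
        using \<delta> by (intro divide_right_mono) auto
      then show "indicator {a..b} (frac (y n)) \<le> t + 4 * e / \<delta> + ((S (z n - t) - S (z n - t - \<delta>)) + (S (z n - \<delta>) - S (z n))) / \<delta>"
        using indicator_le_trapezoid[OF \<delta> ab True, of "y n"]
        by (simp add: z_def t_def add_divide_distrib)
    qed
    also have "\<dots> = real (card B) * (t + 4 * e / \<delta>)
        + ((\<Sum>n\<in>B. S (z n - t) - S (z n - t - \<delta>)) + (\<Sum>n\<in>B. S (z n - \<delta>) - S (z n))) / \<delta>"
      by (simp add: sum.distrib sum_divide_distrib[symmetric])
    also have "\<dots> \<le> real (card B) * (t + 4 * e / \<delta>) + (E * \<delta> / 2 + E * \<delta> / 2) / \<delta>"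
    proof -
      \<comment> \<open>The shifts are paired so that they differ by exactly
        \<open>\<delta>\<close>; this cancels the division by the width of the slopes.\<close>
      have "(\<Sum>n\<in>B. S (y n + c) - S (y n + d)) \<le> E * \<delta> / 2" if cd: "\<bar>c - d\<bar> = \<delta>" for c d
      proof -
        have "(\<Sum>n\<in>B. S (y n + c) - S (y n + d)) = (\<Sum>k=1..K^4.
          (\<Sum>n\<in>B. cos (2 * pi * real k * (y n + c)) - cos (2 * pi * real k * (y n + d))) / (2 * pi\<^sup>2 * (real k)\<^sup>2))"
          unfolding S_def sum_subtractf[symmetric] sum_divide_distrib diff_divide_distrib
          by (rule sum.swap)
        also have "\<dots> \<le> (\<Sum>k=1..K^4. norm (\<Sum>n\<in>B. unit_exp (real k * y n)) / real k * (\<delta> / 2))"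
        proof (rule sum_mono)
          fix k assume k: "k \<in> {1..K^4}"
          define w where "w = norm (\<Sum>n\<in>B. unit_exp (real k * y n))"
          have w: "0 \<le> w" by (simp add: w_def)
          have "(\<Sum>n\<in>B. cos (2 * pi * real k * (y n + c)) - cos (2 * pi * real k * (y n + d))) / (2 * pi\<^sup>2 * (real k)\<^sup>2)
            \<le> (2 * pi * real k * \<delta> * w) / (2 * pi\<^sup>2 * (real k)\<^sup>2)"
            using sum_cos_diff_le[where B = B and k = k and y = y and c = c and d = d]
            unfolding w_def cd by (intro divide_right_mono) auto
          also have "\<dots> = w / real k * (\<delta> / pi)"
            using k by (simp add: power2_eq_square field_simps)
          also have "\<dots> \<le> w / real k * (\<delta> / 2)"
            using w \<delta> pi_ge_two by (intro mult_left_mono divide_left_mono) auto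
          finally show "(\<Sum>n\<in>B. cos (2 * pi * real k * (y n + c)) - cos (2 * pi * real k * (y n + d))) / (2 * pi\<^sup>2 * (real k)\<^sup>2)
            \<le> norm (\<Sum>n\<in>B. unit_exp (real k * y n)) / real k * (\<delta> / 2)"
            unfolding w_def .
        qed
        also have "\<dots> = E * \<delta> / 2" by (simp add: E_def sum_distrib_right)
        finally show ?thesis .
      qed
      from this[of "\<delta> - a - t" "- a - t"] this[of "- a" "\<delta> - a"] \<delta>
      have "(\<Sum>n\<in>B. S (z n - t) - S (z n - t - \<delta>)) \<le> E * \<delta> / 2"
        "(\<Sum>n\<in>B. S (z n - \<delta>) - S (z n)) \<le> E * \<delta> / 2"
        by (simp_all add: z_def algebra_simps)
      then show ?thesis
        using \<delta> by (intro add_left_mono divide_right_mono add_mono) auto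
    qed
    \<comment> \<open>One \<open>\<delta>\<close> is the excess of \<open>t\<close> over
      \<open>b - a\<close>; the other 16 come from four truncation errors
      \<open>4 * \<delta>\<^sup>2\<close> divided by \<open>\<delta>\<close>.\<close>
    also have "\<dots> = real (card B) * (b - a) + 17 * real (card B) * \<delta> + E"
      using \<delta> by (simp add: t_def e_def power2_eq_square field_simps)
    also have "\<dots> \<le> real (card B) * (b - a) + 18 * real (card B) * \<delta> + E"
      using \<delta> by simp
    finally show ?thesis
      unfolding E_def[symmetric] by (simp add: \<delta>_def)
  qed
qed

text \<open>Upper bounds for closed intervals suffice. The lower bound for \<open>I\<close> follows
  by applying them to the two complementary intervals, which explains the doubled constants.\<close>

lemma count_interval_deviation_le:
  assumes "finite B" and K: "K \<ge> 1" and I: "is_interval I" "I \<subseteq> {0..1}"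
  shows "\<bar>real (card {n\<in>B. frac (y n) \<in> I}) - real (card B) * measure lborel I\<bar>
    \<le> 36 * real (card B) / real K + 2 * (\<Sum>k=1..K^4. norm (\<Sum>n\<in>B. unit_exp (real k * y n)) / real k)"
proof -
  define R where "R = 18 * real (card B) / real K + (\<Sum>k=1..K^4. norm (\<Sum>n\<in>B. unit_exp (real k * y n)) / real k)"
  have R: "R \<ge> 0" unfolding R_def by (intro add_nonneg_nonneg sum_nonneg) auto
  have closed: "real (card {n\<in>B. frac (y n) \<in> {a..b}}) \<le> real (card B) * (b - a) + R" if "0 \<le> a" "a \<le> b" for a b
    using count_closed_interval_le[OF assms(1) K that, of y] unfolding R_def by linarith
  have "\<bar>real (card {n\<in>B. frac (y n) \<in> I}) - real (card B) * measure lborel I\<bar> \<le> 2 * R"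
  proof (cases "I = {}")
    case False
    define a b where "a = Inf I" and "b = Sup I"
    have bdd: "bdd_below I" "bdd_above I"
      using I(2) by (auto intro: bdd_below_mono[OF _ I(2)] bdd_above_mono[OF _ I(2)])
    have Iab: "I \<subseteq> {a..b}"
      using bdd by (auto simp: a_def b_def intro: cInf_lower cSup_upper)
    have abI: "{a<..<b} \<subseteq> I"
    proof
      fix x assume x: "x \<in> {a<..<b}"
      obtain u where "u \<in> I" "u < x" using x False bdd by (auto simp: a_def cInf_less_iff)
      moreover obtain v where "v \<in> I" "x < v" using x False bdd by (auto simp: b_def less_cSup_iff)
      ultimately show "x \<in> I" using I(1) less_imp_le[of u x] less_imp_le[of x v] unfolding is_interval_1 by blast
    qed
    have ab: "0 \<le> a" "a \<le> b" "b \<le> 1"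
      using False I(2) Iab by (auto simp: a_def b_def intro!: cInf_greatest cSup_least)
    have Ib: "I \<in> sets lborel"
      using real_interval_borel_measurable[OF I(1)] by simp
    have "emeasure lborel {a<..<b} \<le> emeasure lborel I" "emeasure lborel I \<le> emeasure lborel {a..b}"
      using abI Iab Ib by (auto intro: emeasure_mono)
    then have "emeasure lborel I = ennreal (b - a)" using ab by simp
    then have mI: "measure lborel I = b - a" using ab by (simp add: measure_def)
    have "real (card {n\<in>B. frac (y n) \<in> I}) \<le> real (card {n\<in>B. frac (y n) \<in> {a..b}})"
      using assms(1) Iab by (auto intro!: card_mono)
    then have upper: "real (card {n\<in>B. frac (y n) \<in> I}) \<le> real (card B) * (b - a) + R"
      using closed[of a b] ab by linarith
    have "z \<in> I \<or> z \<in> {0..a} \<or> z \<in> {b..1}" if "0 \<le> z" "z < 1" for z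
      using that abI by (cases "z \<in> {a<..<b}") auto
    \<comment> \<open>The pieces may share the endpoints \<open>a\<close> and \<open>b\<close>; such
      double counting is harmless, as only a covering of \<open>B\<close> is used.\<close>
    then have "B \<subseteq> {n\<in>B. frac (y n) \<in> I} \<union> ({n\<in>B. frac (y n) \<in> {0..a}} \<union> {n\<in>B. frac (y n) \<in> {b..1}})"
      using frac_ge_0 frac_lt_1 by blast
    then have "card B \<le> card ({n\<in>B. frac (y n) \<in> I} \<union> ({n\<in>B. frac (y n) \<in> {0..a}} \<union> {n\<in>B. frac (y n) \<in> {b..1}}))"
      using assms(1) by (intro card_mono) auto
    also have "\<dots> \<le> card {n\<in>B. frac (y n) \<in> I} + (card {n\<in>B. frac (y n) \<in> {0..a}} + card {n\<in>B. frac (y n) \<in> {b..1}})"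
      by (intro order.trans[OF card_Un_le] add_left_mono card_Un_le)
    finally have "real (card B) \<le> real (card {n\<in>B. frac (y n) \<in> I})
        + (real (card {n\<in>B. frac (y n) \<in> {0..a}}) + real (card {n\<in>B. frac (y n) \<in> {b..1}}))"
      by linarith
    then have "real (card B) \<le> real (card {n\<in>B. frac (y n) \<in> I})
        + ((real (card B) * (a - 0) + R) + (real (card B) * (1 - b) + R))"
      using closed[of 0 a] closed[of b 1] ab by linarith
    then have "real (card B) * (b - a) - 2 * R \<le> real (card {n\<in>B. frac (y n) \<in> I})"
      by (simp add: algebra_simps)
    then show ?thesis unfolding mI using upper R by linarith
  qed (use R in simp)
  then show ?thesis by (simp add: R_def)
qed

subsection \<open>Second moments\<close>

lemma unit_exp_measurable [measurable]: "unit_exp \<in> borel_measurable borel"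
  unfolding unit_exp_def[abs_def] by measurable

lemma cnj_unit_exp: "cnj (unit_exp x) = unit_exp (- x)"
  by (simp add: unit_exp_eq_cis cis_cnj)

lemma integrable_unit_exp:
  assumes "prob_space \<mu>" "sets \<mu> = sets borel"
  shows "integrable \<mu> (\<lambda>x. unit_exp (u * x))"
proof -
  interpret prob_space \<mu> by fact
  have [measurable]: "(\<lambda>x. unit_exp (u * x)) \<in> borel_measurable \<mu>"
    unfolding measurable_cong_sets[OF assms(2) refl] by measurable
  show ?thesis by (rule integrable_const_bound[where B = 1]) auto
qed

text \<open>Injectivity keeps every off-diagonal frequency away from 0. This matters because a
  coincidence \<open>a n = a m\<close> would contribute 1 to the moment, while
  \<open>0 powr (- \<eta>) = 0\<close> on the right.\<close>

lemma exponential_sum_second_moment: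
  fixes a :: "nat \<Rightarrow> real"
  assumes \<mu>: "prob_space \<mu>" "sets \<mu> = sets borel"
    and decay: "\<And>u. u \<noteq> 0 \<Longrightarrow> norm (fourier_transform \<mu> u) \<le> c * \<bar>u\<bar> powr (- \<eta>)"
    and B: "finite B" "inj_on a B" and k: "k \<ge> 1"
  shows "integrable \<mu> (\<lambda>x. (norm (\<Sum>n\<in>B. unit_exp (real k * (a n * x))))\<^sup>2)" (is ?int)
    and "(LINT x|\<mu>. (norm (\<Sum>n\<in>B. unit_exp (real k * (a n * x))))\<^sup>2)
      \<le> real (card B) + c * real k powr (- \<eta>) * (\<Sum>n\<in>B. \<Sum>m\<in>B - {n}. \<bar>a n - a m\<bar> powr (- \<eta>))" (is ?le)
proof -
  interpret prob_space \<mu> by fact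
  \<comment> \<open>The minus sign matches the kernel \<open>unit_exp (- u * x)\<close> of the
    Fourier transform at \<open>u = k * (a m - a n)\<close>.\<close>
  define E where "E = (\<lambda>n m x. unit_exp (- (real k * (a m - a n)) * x))"
  have E: "integrable \<mu> (E n m)" for n m
    unfolding E_def by (rule integrable_unit_exp[OF \<mu>])
  have eq: "(norm (\<Sum>n\<in>B. unit_exp (real k * (a n * x))))\<^sup>2 = (\<Sum>n\<in>B. \<Sum>m\<in>B. Re (E n m x))" for x
  proof -
    have "complex_of_real ((norm (\<Sum>n\<in>B. unit_exp (real k * (a n * x))))\<^sup>2)
      = (\<Sum>n\<in>B. unit_exp (real k * (a n * x))) * cnj (\<Sum>m\<in>B. unit_exp (real k * (a m * x)))"
      by (rule complex_norm_square)
    also have "\<dots> = (\<Sum>n\<in>B. \<Sum>m\<in>B. unit_exp (real k * (a n * x)) * unit_exp (- (real k * (a m * x))))"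
      by (simp add: cnj_unit_exp sum_product)
    also have "\<dots> = (\<Sum>n\<in>B. \<Sum>m\<in>B. E n m x)"
      unfolding E_def unit_exp_add[symmetric] by (simp add: algebra_simps)
    finally have "Re (complex_of_real ((norm (\<Sum>n\<in>B. unit_exp (real k * (a n * x))))\<^sup>2))
      = Re (\<Sum>n\<in>B. \<Sum>m\<in>B. E n m x)" by (rule arg_cong)
    then show ?thesis by simp
  qed
  show ?int
    unfolding eq by (intro Bochner_Integration.integrable_sum integrable_Re E)
  have F: "fourier_transform \<mu> (real k * (a m - a n)) = (LINT x|\<mu>. E n m x)" for n m
    by (simp only: fourier_transform_def E_def)
  have "(LINT x|\<mu>. (norm (\<Sum>n\<in>B. unit_exp (real k * (a n * x))))\<^sup>2)
      = (\<Sum>n\<in>B. \<Sum>m\<in>B. Re (fourier_transform \<mu> (real k * (a m - a n))))"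
    unfolding eq F
    by (simp add: Bochner_Integration.integral_sum integrable_Re E integral_Re)
  also have "\<dots> \<le> (\<Sum>n\<in>B. 1 + c * real k powr (- \<eta>) * (\<Sum>m\<in>B - {n}. \<bar>a n - a m\<bar> powr (- \<eta>)))"
  proof (rule sum_mono)
    fix n assume n: "n \<in> B"
    have "fourier_transform \<mu> 0 = 1"
      by (simp add: fourier_transform_def unit_exp_def prob_space)
    then have "(\<Sum>m\<in>B. Re (fourier_transform \<mu> (real k * (a m - a n))))
      = 1 + (\<Sum>m\<in>B - {n}. Re (fourier_transform \<mu> (real k * (a m - a n))))"
      using n B(1) by (subst sum.remove[of _ n]) auto
    also have "(\<Sum>m\<in>B - {n}. Re (fourier_transform \<mu> (real k * (a m - a n))))
      \<le> (\<Sum>m\<in>B - {n}. c * real k powr (- \<eta>) * \<bar>a n - a m\<bar> powr (- \<eta>))"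
    proof (rule sum_mono)
      fix m assume m: "m \<in> B - {n}"
      then have ne: "a m \<noteq> a n" using n B(2) by (auto dest: inj_onD)
      have "Re (fourier_transform \<mu> (real k * (a m - a n))) \<le> c * \<bar>real k * (a m - a n)\<bar> powr (- \<eta>)"
        using decay[of "real k * (a m - a n)"] ne k complex_Re_le_cmod by (force intro: order.trans)
      also have "\<bar>real k * (a m - a n)\<bar> powr (- \<eta>) = real k powr (- \<eta>) * \<bar>a n - a m\<bar> powr (- \<eta>)"
        by (simp add: abs_mult powr_mult abs_minus_commute)
      finally show "Re (fourier_transform \<mu> (real k * (a m - a n))) \<le> c * real k powr (- \<eta>) * \<bar>a n - a m\<bar> powr (- \<eta>)"
        by (simp add: mult.assoc)
    qed
    finally show "(\<Sum>m\<in>B. Re (fourier_transform \<mu> (real k * (a m - a n))))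
      \<le> 1 + c * real k powr (- \<eta>) * (\<Sum>m\<in>B - {n}. \<bar>a n - a m\<bar> powr (- \<eta>))"
      by (simp add: sum_distrib_left)
  qed
  also have "\<dots> = real (card B) + c * real k powr (- \<eta>) * (\<Sum>n\<in>B. \<Sum>m\<in>B - {n}. \<bar>a n - a m\<bar> powr (- \<eta>))"
    by (simp add: sum.distrib sum_distrib_left)
  finally show ?le .
qed

lemma sum_inverse_le_ln: "n \<ge> 1 \<Longrightarrow> (\<Sum>k=1..n. 1 / real k) \<le> 1 + ln (real n)"
proof -
  assume n: "n \<ge> 1"
  have "harm (Suc (n - 1)) - ln (real (Suc (n - 1))) \<le> harm (Suc 0) - ln (real (Suc 0))"
    using decseq_harm_diff_ln by (rule decseqD) simp
  then show ?thesis using n by (simp add: harm_def inverse_eq_divide)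
qed

text \<open>The bound of \<open>count_interval_deviation_le\<close> for the block
  \<open>{u..v}\<close> with \<open>K = v\<close>. It does not depend on the interval, and this
  \<open>K\<close> keeps the first term at most 36.\<close>

definition weyl_bound :: "(nat \<Rightarrow> real) \<Rightarrow> nat \<Rightarrow> nat \<Rightarrow> real \<Rightarrow> real" where
  "weyl_bound a u v x = 36 * real (card {u..v}) / real v
     + 2 * (\<Sum>k=1..v^4. norm (\<Sum>n=u..v. unit_exp (real k * (a n * x))) / real k)"

text \<open>Cauchy-Schwarz with weights \<open>1 / k\<close> costs a harmonic sum of order
  \<open>1 + ln v\<close>. The diagonal brings a second one, hence the squared logarithm. Off the
  diagonal the sum over \<open>k\<close> of \<open>k powr (- 1 - \<eta>)\<close> converges, and the
  factor \<open>1 / ln v\<close> in the hypothesis cancels the single logarithm.\<close>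

lemma weyl_bound_second_moment:
  fixes a \<psi> :: "nat \<Rightarrow> real"
  assumes \<mu>: "prob_space \<mu>" "sets \<mu> = sets borel" and \<eta>: "\<eta> > 0" and "fourier_decay \<mu> \<eta>"
    and \<psi>: "\<And>n. n \<ge> 1 \<Longrightarrow> \<psi> n \<ge> 0"
    and a: "inj_on a {1..}"
    and C0: "C0 > 0" "\<And>u v. 1 \<le> u \<Longrightarrow> u < v \<Longrightarrow>
           (\<Sum>n=u..v. \<Sum>m\<in>{u..v} - {n}. \<bar>a n - a m\<bar> powr (- \<eta>))
             \<le> C0 * (1 / ln (real v) * (\<Sum>n=u..v. \<psi> n))"
  obtains C where "C > 0"
    "\<And>u v. 1 \<le> u \<Longrightarrow> u \<le> v \<Longrightarrow> integrable \<mu> (\<lambda>x. (weyl_bound a u v x)\<^sup>2)"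
    "\<And>u v. 1 \<le> u \<Longrightarrow> u \<le> v \<Longrightarrow> (LINT x|\<mu>. (weyl_bound a u v x)\<^sup>2)
        \<le> C * ((1 + ln (real v))\<^sup>2 * real (card {u..v}) + (\<Sum>n=u..v. \<psi> n))"
proof -
  interpret prob_space \<mu> by fact
  obtain c where c: "c > 0" and decay: "\<And>u. u \<noteq> 0 \<Longrightarrow> norm (fourier_transform \<mu> u) \<le> c * \<bar>u\<bar> powr (- \<eta>)"
    using assms(4) unfolding fourier_decay_def by auto
  define Z where "Z = (\<Sum>k. real k powr (- 1 - \<eta>))"
  have summ: "summable (\<lambda>k. real k powr (- 1 - \<eta>))"
    using \<eta> by (simp add: summable_real_powr_iff)
  have Z0: "Z \<ge> 0" unfolding Z_def by (rule suminf_nonneg[OF summ]) auto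
  have Z: "(\<Sum>k=1..n. real k powr (- 1 - \<eta>)) \<le> Z" for n
    unfolding Z_def by (rule sum_le_suminf[OF summ]) auto
  \<comment> \<open>Here \<open>2720 = 2 * 36\<^sup>2 + 8 * 4\<^sup>2\<close> collects the constant
    term and the diagonal, and \<open>96 = 8 * 12\<close> the off-diagonal part.\<close>
  define C where "C = 2720 + 96 * c * C0 * Z"
  have *: "integrable \<mu> (\<lambda>x. (weyl_bound a u v x)\<^sup>2)" (is ?int)
    "(LINT x|\<mu>. (weyl_bound a u v x)\<^sup>2)
        \<le> C * ((1 + ln (real v))\<^sup>2 * real (card {u..v}) + (\<Sum>n=u..v. \<psi> n))" (is ?le)
    if uv: "1 \<le> u" "u \<le> v" for u v
  proof -
    define s where "s = (\<lambda>k x. norm (\<Sum>n=u..v. unit_exp (real k * (a n * x))))"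
    define R where "R = (\<Sum>n=u..v. \<Sum>m\<in>{u..v} - {n}. \<bar>a n - a m\<bar> powr (- \<eta>))"
    define H where "H = (\<Sum>k=1..v^4. 1 / real k)"
    define b where "b = real (card {u..v})"
    define P where "P = (\<Sum>n=u..v. \<psi> n)"
    have inj: "inj_on a {u..v}" using a by (rule inj_on_subset) (use uv in auto)
    have s_int: "integrable \<mu> (\<lambda>x. (s k x)\<^sup>2)"
      and s_le: "(LINT x|\<mu>. (s k x)\<^sup>2) \<le> b + c * real k powr (- \<eta>) * R" if "k \<ge> 1" for k
      unfolding s_def R_def b_def
      using exponential_sum_second_moment[OF \<mu> decay _ inj that] by auto
    have b: "1 \<le> b" "b \<le> real v" using uv by (auto simp: b_def)
    have H0: "H \<ge> 0" unfolding H_def by (intro sum_nonneg) auto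
    have P0: "P \<ge> 0" unfolding P_def using \<psi> uv by (intro sum_nonneg) auto
    have lnv: "ln (real v) \<ge> 0" using uv by simp
    have H: "H \<le> 4 * (1 + ln (real v))"
    proof -
      have "H \<le> 1 + ln (real (v^4))"
        unfolding H_def using uv by (intro sum_inverse_le_ln) auto
      also have "ln (real (v^4)) = 4 * ln (real v)"
        using uv by (simp add: ln_realpow)
      finally show ?thesis by simp
    qed
    \<comment> \<open>A one-point block has no off-diagonal terms. Otherwise
      \<open>v \<ge> 2\<close>, so \<open>ln v \<ge> 1 / 2\<close> and
      \<open>(1 + ln v) / ln v \<le> 3\<close>; the factor 4 comes from the \<open>v^4\<close>
      frequencies.\<close>
    have HR: "H * R \<le> 12 * C0 * P"
    proof (cases "u = v")
      case True
      then have "R = 0" by (simp add: R_def)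
      then show ?thesis using C0(1) P0 by simp
    next
      case False
      then have uv': "u < v" "v \<ge> 2" using uv by auto
      have "1 / 2 \<le> ln (2::real)" using ln2_ge_two_thirds by simp
      also have "ln 2 \<le> ln (real v)" using uv' by simp
      finally have l: "1 / 2 \<le> ln (real v)" .
      have "H * R \<le> 4 * (1 + ln (real v)) * (C0 * (1 / ln (real v) * P))"
        using H C0(2)[OF uv(1) uv'(1)] H0 lnv
        by (intro mult_mono) (auto simp: R_def P_def intro!: sum_nonneg)
      also have "\<dots> = 4 * C0 * P * (1 + 1 / ln (real v))"
        using l by (simp add: field_simps)
      also have "\<dots> \<le> 4 * C0 * P * 3"
        using l C0(1) P0 by (intro mult_left_mono) (auto simp: field_simps)
      finally show ?thesis by simp
    qed
    define M where "M = (\<lambda>x. 2592 + 8 * H * (\<Sum>k=1..v^4. (s k x)\<^sup>2 / real k))"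
    have M_int: "integrable \<mu> M"
      unfolding M_def by (intro Bochner_Integration.integrable_add integrable_mult_right Bochner_Integration.integrable_sum integrable_divide) (auto intro: s_int)
    have dom: "(weyl_bound a u v x)\<^sup>2 \<le> M x" for x
    proof -
      have w: "weyl_bound a u v x = 36 * b / real v + 2 * (\<Sum>k=1..v^4. s k x / real k)"
        by (simp add: weyl_bound_def b_def s_def)
      have "(p + q)\<^sup>2 \<le> 2 * p\<^sup>2 + 2 * q\<^sup>2" for p q :: real
        using zero_le_power2[of "p - q"] by (simp add: power2_eq_square algebra_simps)
      then have "(weyl_bound a u v x)\<^sup>2 \<le> 2 * (36 * b / real v)\<^sup>2 + 2 * (2 * (\<Sum>k=1..v^4. s k x / real k))\<^sup>2"
        unfolding w .
      also have "\<dots> = 2 * (36 * b / real v)\<^sup>2 + 8 * (\<Sum>k=1..v^4. s k x / real k)\<^sup>2"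
        by (simp add: power_mult_distrib)
      also have "(36 * b / real v)\<^sup>2 \<le> 36\<^sup>2"
        using b uv by (intro power_mono) (auto simp: field_simps)
      \<comment> \<open>The weight \<open>1 / k\<close> is shared equally between the two factors of
        Cauchy-Schwarz.\<close>
      also have "(\<Sum>k=1..v^4. s k x / real k)\<^sup>2 = (\<Sum>k=1..v^4. (1 / sqrt (real k)) * (s k x / sqrt (real k)))\<^sup>2"
        by (intro arg_cong[where f = "\<lambda>t. t\<^sup>2"] sum.cong) auto
      also have "\<dots> \<le> (\<Sum>k=1..v^4. (1 / sqrt (real k))\<^sup>2) * (\<Sum>k=1..v^4. (s k x / sqrt (real k))\<^sup>2)"
        by (rule Cauchy_Schwarz_ineq_sum)
      also have "\<dots> = H * (\<Sum>k=1..v^4. (s k x)\<^sup>2 / real k)"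
        by (simp add: H_def power_divide)
      finally show ?thesis by (simp add: M_def)
    qed
    have [measurable]: "weyl_bound a u v \<in> borel_measurable \<mu>"
      unfolding measurable_cong_sets[OF \<mu>(2) refl] weyl_bound_def[abs_def] by measurable
    show int: ?int
      by (rule Bochner_Integration.integrable_bound[OF M_int]) (use dom in \<open>auto intro!: AE_I2 order.trans[OF dom]\<close>)
    have "(LINT x|\<mu>. (weyl_bound a u v x)\<^sup>2) \<le> (LINT x|\<mu>. M x)"
      by (rule integral_mono[OF int M_int dom])
    also have "\<dots> = 2592 + 8 * H * (\<Sum>k=1..v^4. (LINT x|\<mu>. (s k x)\<^sup>2) / real k)"
    proof -
      have "(LINT x|\<mu>. (\<Sum>k=1..v^4. (s k x)\<^sup>2 / real k)) = (\<Sum>k=1..v^4. (LINT x|\<mu>. (s k x)\<^sup>2 / real k))"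
        by (intro Bochner_Integration.integral_sum integrable_divide) (auto intro: s_int)
      moreover have "integrable \<mu> (\<lambda>x. 8 * H * (\<Sum>k=1..v^4. (s k x)\<^sup>2 / real k))"
        by (intro integrable_mult_right Bochner_Integration.integrable_sum integrable_divide) (auto intro: s_int)
      ultimately show ?thesis
        unfolding M_def by (simp add: prob_space)
    qed
    also have "\<dots> \<le> 2592 + 8 * H * (\<Sum>k=1..v^4. b * (1 / real k) + c * R * real k powr (- 1 - \<eta>))"
    proof (intro add_left_mono mult_left_mono sum_mono)
      fix k assume k: "k \<in> {1..v^4}"
      have "(LINT x|\<mu>. (s k x)\<^sup>2) / real k \<le> (b + c * real k powr (- \<eta>) * R) / real k"
        using k by (intro divide_right_mono s_le) auto
      also have "\<dots> = b * (1 / real k) + c * R * real k powr (- 1 - \<eta>)"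
      proof -
        have "real k powr (- 1 - \<eta>) = real k powr (- \<eta>) / real k"
          using k powr_add[of "real k" "- 1" "- \<eta>"] by (simp add: powr_minus_divide)
        then show ?thesis by (simp add: add_divide_distrib mult_ac)
      qed
      finally show "(LINT x|\<mu>. (s k x)\<^sup>2) / real k \<le> b * (1 / real k) + c * R * real k powr (- 1 - \<eta>)" .
    qed (use H0 in auto)
    also have "\<dots> = 2592 + 8 * b * H\<^sup>2 + 8 * c * (H * R) * (\<Sum>k=1..v^4. real k powr (- 1 - \<eta>))"
    proof -
      have "(\<Sum>k=1..v^4. b * (1 / real k) + c * R * real k powr (- 1 - \<eta>))
        = b * H + c * R * (\<Sum>k=1..v^4. real k powr (- 1 - \<eta>))"
        unfolding H_def by (simp only: sum.distrib sum_distrib_left)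
      then show ?thesis by (simp add: power2_eq_square algebra_simps)
    qed
    also have "\<dots> \<le> 2592 * ((1 + ln (real v))\<^sup>2 * b) + 8 * b * (4 * (1 + ln (real v)))\<^sup>2 + 8 * c * (12 * C0 * P) * Z"
    proof (intro add_mono)
      have "1 * 1 \<le> (1 + ln (real v))\<^sup>2 * b"
        using b lnv by (intro mult_mono) auto
      then show "2592 \<le> 2592 * ((1 + ln (real v))\<^sup>2 * b)" by simp
      show "8 * b * H\<^sup>2 \<le> 8 * b * (4 * (1 + ln (real v)))\<^sup>2"
        using b H H0 by (intro mult_left_mono power_mono) auto
      show "8 * c * (H * R) * (\<Sum>k=1..v^4. real k powr (- 1 - \<eta>)) \<le> 8 * c * (12 * C0 * P) * Z"
        by (rule mult_mono[OF mult_left_mono[OF HR] Z]) (use c C0(1) P0 in \<open>auto intro!: sum_nonneg\<close>)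
    qed
    also have "\<dots> = 2720 * ((1 + ln (real v))\<^sup>2 * b) + 96 * c * C0 * Z * P"
      by (simp only: power_mult_distrib) (simp add: algebra_simps)
    also have "\<dots> \<le> C * ((1 + ln (real v))\<^sup>2 * b) + C * P"
      unfolding C_def using c C0(1) Z0 b P0 by (intro add_mono mult_right_mono) auto
    finally show ?le by (simp add: b_def P_def algebra_simps)
  qed
  have "C > 0" unfolding C_def using c C0(1) Z0 by (intro add_pos_nonneg) auto
  then show ?thesis using * that by blast
qed

subsection \<open>Dyadic blocks\<close>

text \<open>Kept without absolute value so that it is additive over disjoint blocks.\<close>

definition count_deviation :: "(nat \<Rightarrow> real) \<Rightarrow> real set \<Rightarrow> nat set \<Rightarrow> real" where
  "count_deviation y I B = real (card {n\<in>B. frac (y n) \<in> I}) - real (card B) * measure lborel I"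

lemma count_deviation_Un:
  assumes "finite A" "finite B" "A \<inter> B = {}"
  shows "count_deviation y I (A \<union> B) = count_deviation y I A + count_deviation y I B"
proof -
  have "{n\<in>A \<union> B. frac (y n) \<in> I} = {n\<in>A. frac (y n) \<in> I} \<union> {n\<in>B. frac (y n) \<in> I}" by auto
  moreover have "card \<dots> = card {n\<in>A. frac (y n) \<in> I} + card {n\<in>B. frac (y n) \<in> I}"
    using assms by (intro card_Un_disjoint) auto
  ultimately show ?thesis
    using assms by (simp add: count_deviation_def card_Un_disjoint algebra_simps)
qed

lemma count_deviation_diff:
  assumes "p \<le> q"
  shows "count_deviation y I {1..q} - count_deviation y I {1..p} = count_deviation y I {p+1..q}"
proof -
  have "{1..q} = {1..p} \<union> {p+1..q}" using assms by auto
  then show ?thesis using count_deviation_Un[of "{1..p}" "{p+1..q}" y I] by auto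
qed

text \<open>Level \<open>i\<close> runs over the complete dyadic blocks of length \<open>2^i\<close>
  inside \<open>{1..N}\<close>, so only indices up to \<open>N\<close> enter.\<close>

definition dyadic_square_sum :: "(nat \<Rightarrow> real) \<Rightarrow> nat \<Rightarrow> nat \<Rightarrow> real \<Rightarrow> real" where
  "dyadic_square_sum a L N x = (\<Sum>i<L. \<Sum>t<N div 2^i. (weyl_bound a (t * 2^i + 1) ((t + 1) * 2^i) x)\<^sup>2)"

lemma dyadic_square_sum_nonneg: "dyadic_square_sum a L N x \<ge> 0"
  unfolding dyadic_square_sum_def by (intro sum_nonneg) auto

text \<open>A Rademacher-Menshov argument: the binary expansion of \<open>N\<close> splits
  \<open>{1..N}\<close> into at most one dyadic block per level, and Cauchy-Schwarz over the
  \<open>L\<close> levels costs the factor \<open>L\<close>. The right-hand side is the same for all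
  \<open>N \<le> N'\<close> and all intervals.\<close>

lemma count_deviation_sq_le:
  assumes I: "is_interval I" "I \<subseteq> {0..1}" and N: "N \<le> N'" "N' < 2^L"
  shows "(count_deviation (\<lambda>n. a n * x) I {1..N})\<^sup>2 \<le> real L * dyadic_square_sum a L N' x"
proof -
  define d where "d = count_deviation (\<lambda>n. a n * x) I"
  define T where "T = (\<lambda>i t. weyl_bound a (t * 2^i + 1) ((t + 1) * 2^i) x)"
  \<comment> \<open>The value \<open>r i\<close> is \<open>N\<close> rounded down to a multiple of
    \<open>2^i\<close>; it decreases from \<open>r 0 = N\<close> to \<open>r L = 0\<close>.\<close>
  define r where "r = (\<lambda>i. N div 2^i * 2^i)"
  \<comment> \<open>If bit \<open>i\<close> of \<open>N\<close> is 0, rounding to the next level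
    changes nothing. If it is 1, the gap is the dyadic block with the even index
    \<open>2 * (N div 2^Suc i)\<close>.\<close>
  have step: "r i = r (Suc i) \<or> (r i = r (Suc i) + 2^i \<and> r (Suc i) = 2 * (N div 2^Suc i) * 2^i
      \<and> 2 * (N div 2^Suc i) < N' div 2^i)" for i
  proof -
    define m q where "m = N div 2^i" and "q = m div 2"
    have m: "N div 2^Suc i = q" by (simp only: q_def m_def power_Suc2 div_mult2_eq)
    have "m \<le> N' div 2^i" unfolding m_def using N(1) by (rule div_le_mono)
    moreover have "m = 2 * q \<or> m = 2 * q + 1" unfolding q_def by presburger
    moreover have "r i = m * 2^i" by (simp add: r_def m_def)
    moreover have "r (Suc i) = 2 * q * 2^i" unfolding r_def m by simp
    ultimately show ?thesis unfolding m by (auto simp: algebra_simps)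
  qed
  have mono: "r (Suc i) \<le> r i" for i using step[of i] by linarith
  have "d {1..N} = d {1..r 0} - d {1..r L}"
    using N by (simp add: r_def d_def count_deviation_def)
  also have "\<dots> = (\<Sum>i<L. d {1..r i} - d {1..r (Suc i)})"
    by (rule sum_lessThan_telescope'[symmetric])
  also have "\<dots> = (\<Sum>i<L. d {r (Suc i) + 1..r i})"
    unfolding d_def using mono by (intro sum.cong count_deviation_diff) auto
  finally have "(d {1..N})\<^sup>2 \<le> (\<Sum>i<L. (d {r (Suc i) + 1..r i})\<^sup>2) * real (card {..<L})"
    using sum_squared_le_sum_of_squares[of "\<lambda>i. d {r (Suc i) + 1..r i}" "{..<L}"] by simp
  also have "\<dots> = real L * (\<Sum>i<L. (d {r (Suc i) + 1..r i})\<^sup>2)" by simp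
  also have "\<dots> \<le> real L * (\<Sum>i<L. \<Sum>t<N' div 2^i. (T i t)\<^sup>2)"
  proof (intro mult_left_mono sum_mono)
    fix i
    show "(d {r (Suc i) + 1..r i})\<^sup>2 \<le> (\<Sum>t<N' div 2^i. (T i t)\<^sup>2)"
    proof (cases "r i = r (Suc i)")
      case True
      then show ?thesis by (simp add: d_def count_deviation_def sum_nonneg)
    next
      case False
      define t where "t = 2 * (N div 2^Suc i)"
      have t: "r (Suc i) = t * 2^i" "r i = (t + 1) * 2^i" "t < N' div 2^i"
        using step[of i] False by (auto simp: t_def)
      have pos: "(t + 1) * 2^i \<ge> 1" by (simp add: Suc_le_eq)
      have "\<bar>d {t * 2^i + 1..(t + 1) * 2^i}\<bar> \<le> T i t"
        unfolding d_def T_def count_deviation_def weyl_bound_def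
        by (rule count_interval_deviation_le[OF finite_atLeastAtMost pos I])
      then have "(d {r (Suc i) + 1..r i})\<^sup>2 \<le> (T i t)\<^sup>2"
        unfolding t by (simp add: abs_le_square_iff[symmetric])
      also have "\<dots> \<le> (\<Sum>t<N' div 2^i. (T i t)\<^sup>2)"
        using t(3) by (intro member_le_sum) auto
      finally show ?thesis .
    qed
  qed auto
  finally show ?thesis by (simp add: d_def T_def dyadic_square_sum_def)
qed

section \<open>Second moments of the dyadic sums\<close>

lemma sum_blocks:
  fixes f :: "nat \<Rightarrow> 'a::comm_monoid_add"
  shows "(\<Sum>t<q. \<Sum>n=t * w + 1..(t + 1) * w. f n) = (\<Sum>n=1..q * w. f n)"
proof (induction q)
  case (Suc q)
  have "{1..Suc q * w} = {1..q * w} \<union> {q * w + 1..(q + 1) * w}" by auto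
  then have "(\<Sum>n=1..Suc q * w. f n) = (\<Sum>n=1..q * w. f n) + (\<Sum>n=q * w + 1..(q + 1) * w. f n)"
    by (simp only:) (rule sum.union_disjoint, auto)
  then show ?case using Suc by simp
qed simp

text \<open>On each level the blocks are disjoint parts of \<open>{1..N}\<close>, so their bounds
  add up to at most the bound for the whole range; there are \<open>L\<close> levels.\<close>

lemma dyadic_square_sum_integral:
  fixes a \<psi> :: "nat \<Rightarrow> real"
  assumes \<psi>: "\<And>n. n \<ge> 1 \<Longrightarrow> \<psi> n \<ge> 0" and C: "C \<ge> 0"
    and int: "\<And>u v. 1 \<le> u \<Longrightarrow> u \<le> v \<Longrightarrow> integrable \<mu> (\<lambda>x. (weyl_bound a u v x)\<^sup>2)"
    and le: "\<And>u v. 1 \<le> u \<Longrightarrow> u \<le> v \<Longrightarrow> (LINT x|\<mu>. (weyl_bound a u v x)\<^sup>2)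
        \<le> C * ((1 + ln (real v))\<^sup>2 * real (card {u..v}) + (\<Sum>n=u..v. \<psi> n))"
  shows "integrable \<mu> (dyadic_square_sum a L N)"
    and "(LINT x|\<mu>. dyadic_square_sum a L N x)
      \<le> real L * (C * ((1 + ln (real N))\<^sup>2 * real N + (\<Sum>n=1..N. \<psi> n)))"
proof -
  have uv: "1 \<le> t * 2^i + 1" "t * 2^i + 1 \<le> (t + 1) * 2^i" for t i :: nat
    by (auto simp: Suc_le_eq)
  note int' = int[OF uv]
  show "integrable \<mu> (dyadic_square_sum a L N)"
    unfolding dyadic_square_sum_def[abs_def] by (intro Bochner_Integration.integrable_sum int')
  have "(LINT x|\<mu>. dyadic_square_sum a L N x)
     = (\<Sum>i<L. \<Sum>t<N div 2^i. (LINT x|\<mu>. (weyl_bound a (t * 2^i + 1) ((t + 1) * 2^i) x)\<^sup>2))"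
    unfolding dyadic_square_sum_def
    by (subst Bochner_Integration.integral_sum, intro Bochner_Integration.integrable_sum int', intro sum.cong refl Bochner_Integration.integral_sum int')
  also have "\<dots> \<le> (\<Sum>i<L. C * ((1 + ln (real N))\<^sup>2 * real N + (\<Sum>n=1..N. \<psi> n)))"
  proof (rule sum_mono)
    fix i
    have "(\<Sum>t<N div 2^i. (LINT x|\<mu>. (weyl_bound a (t * 2^i + 1) ((t + 1) * 2^i) x)\<^sup>2))
      \<le> (\<Sum>t<N div 2^i. C * ((\<Sum>n=t * 2^i + 1..(t + 1) * 2^i. (1 + ln (real N))\<^sup>2) + (\<Sum>n=t * 2^i + 1..(t + 1) * 2^i. \<psi> n)))"
    proof (rule sum_mono)
      fix t assume t: "t \<in> {..<N div 2^i}"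
      have "(t + 1) * 2^i \<le> N div 2^i * 2^i" using t by (intro mult_right_mono) auto
      also have "\<dots> \<le> N" by simp
      finally have tN: "real ((t + 1) * 2^i) \<le> real N" by (rule of_nat_mono)
      have "(0::nat) < (t + 1) * 2^i" by simp
      then have t1: "1 \<le> real ((t + 1) * 2^i)" by linarith
      have "(1 + ln (real ((t + 1) * 2^i)))\<^sup>2 \<le> (1 + ln (real N))\<^sup>2"
        using t1 tN by (intro power_mono add_left_mono ln_mono add_nonneg_nonneg ln_ge_zero) linarith+
      then have "(1 + ln (real ((t + 1) * 2^i)))\<^sup>2 * real (card {t * 2^i + 1..(t + 1) * 2^i})
         \<le> (\<Sum>n=t * 2^i + 1..(t + 1) * 2^i. (1 + ln (real N))\<^sup>2)"
        by (simp add: mult_right_mono mult.commute)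
      then show "(LINT x|\<mu>. (weyl_bound a (t * 2^i + 1) ((t + 1) * 2^i) x)\<^sup>2)
        \<le> C * ((\<Sum>n=t * 2^i + 1..(t + 1) * 2^i. (1 + ln (real N))\<^sup>2) + (\<Sum>n=t * 2^i + 1..(t + 1) * 2^i. \<psi> n))"
        using C by (intro order.trans[OF le[OF uv]] mult_left_mono add_right_mono)
    qed
    also have "\<dots> = C * ((\<Sum>n=1..N div 2^i * 2^i. (1 + ln (real N))\<^sup>2) + (\<Sum>n=1..N div 2^i * 2^i. \<psi> n))"
      unfolding sum_distrib_left[symmetric] sum.distrib sum_blocks ..
    also have "\<dots> \<le> C * ((\<Sum>n=1..N. (1 + ln (real N))\<^sup>2) + (\<Sum>n=1..N. \<psi> n))"
    proof -
      have "{1..N div 2^i * 2^i} \<subseteq> {1..N}"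
        using order.trans[OF _ div_times_less_eq_dividend[of N "2^i"]] by auto
      then show ?thesis
        using C \<psi> by (intro mult_left_mono add_mono sum_mono2) auto
    qed
    also have "\<dots> = C * ((1 + ln (real N))\<^sup>2 * real N + (\<Sum>n=1..N. \<psi> n))" by simp
    finally show "(\<Sum>t<N div 2^i. (LINT x|\<mu>. (weyl_bound a (t * 2^i + 1) ((t + 1) * 2^i) x)\<^sup>2))
      \<le> C * ((1 + ln (real N))\<^sup>2 * real N + (\<Sum>n=1..N. \<psi> n))" .
  qed
  also have "\<dots> = real L * (C * ((1 + ln (real N))\<^sup>2 * real N + (\<Sum>n=1..N. \<psi> n)))" by simp
  finally show "(LINT x|\<mu>. dyadic_square_sum a L N x)
      \<le> real L * (C * ((1 + ln (real N))\<^sup>2 * real N + (\<Sum>n=1..N. \<psi> n)))" .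
qed

text \<open>By monotone convergence the series of the \<open>Y j\<close> has finite integral, so it
  is finite almost everywhere, and it dominates each of its terms.\<close>

lemma AE_bounded_of_summable_integrals:
  fixes Y :: "nat \<Rightarrow> 'a \<Rightarrow> real"
  assumes int: "\<And>j. integrable M (Y j)" and nonneg: "\<And>j x. Y j x \<ge> 0"
    and le: "\<And>j. (LINT x|M. Y j x) \<le> b j" and b: "summable b"
  shows "AE x in M. \<exists>C\<ge>0. \<forall>j. Y j x \<le> C"
proof -
  have [measurable]: "Y j \<in> borel_measurable M" for j
    using int by auto
  have b0: "b j \<ge> 0" for j
    by (rule order.trans[OF _ le]) (simp add: nonneg)
  have "(\<integral>\<^sup>+x. (\<Sum>j. ennreal (Y j x)) \<partial>M) = (\<Sum>j. \<integral>\<^sup>+x. ennreal (Y j x) \<partial>M)"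
    by (rule nn_integral_suminf) measurable
  also have "\<dots> \<le> (\<Sum>j. ennreal (b j))"
    by (intro suminf_le allI) (auto simp: nn_integral_eq_integral int nonneg intro!: ennreal_leI le)
  also have "\<dots> < top"
    using suminf_ennreal2[OF b0 b] by simp
  finally have "(\<integral>\<^sup>+x. (\<Sum>j. ennreal (Y j x)) \<partial>M) \<noteq> \<infinity>" by simp
  then have "AE x in M. (\<Sum>j. ennreal (Y j x)) \<noteq> \<infinity>"
    by (intro nn_integral_PInf_AE) measurable
  then show ?thesis
  proof eventually_elim
    case (elim x)
    have "Y j x \<le> enn2real (\<Sum>j. ennreal (Y j x))" for j
    proof -
      have "ennreal (Y j x) \<le> (\<Sum>j. ennreal (Y j x))"
        using sum_le_suminf[of "\<lambda>j. ennreal (Y j x)" "{j}"] by simp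
      then have "enn2real (ennreal (Y j x)) \<le> enn2real (\<Sum>j. ennreal (Y j x))"
        using elim by (intro enn2real_mono) (auto simp: less_top)
      then show ?thesis by (simp add: nonneg)
    qed
    then show ?case using enn2real_nonneg by blast
  qed
qed

subsection \<open>The almost everywhere bound\<close>

lemma le_mult_ln_sq_add:
  assumes "N \<ge> 3" "S \<ge> 0"
  shows "real N \<le> real N * (ln (real N))\<^sup>2 + S"
    and "(1 + ln (real N))\<^sup>2 * real N + S \<le> 4 * (real N * (ln (real N))\<^sup>2 + S)"
proof -
  \<comment> \<open>From \<open>N \<ge> 3 > e\<close> the logarithm is at least 1, so
    \<open>1 + ln N\<close> may be replaced by \<open>2 * ln N\<close>.\<close>
  have "exp 1 \<le> real N" using exp_le assms(1) by linarith
  then have l: "1 \<le> ln (real N)" using assms(1) by (simp add: ln_ge_iff)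
  then have "1 \<le> (ln (real N))\<^sup>2" by simp
  then have "real N * 1 \<le> real N * (ln (real N))\<^sup>2" by (intro mult_left_mono) auto
  then show "real N \<le> real N * (ln (real N))\<^sup>2 + S" using assms(2) by simp
  have "(1 + ln (real N))\<^sup>2 \<le> (2 * ln (real N))\<^sup>2" using l by (intro power_mono) auto
  then have "(1 + ln (real N))\<^sup>2 * real N \<le> (2 * ln (real N))\<^sup>2 * real N"
    by (intro mult_right_mono) auto
  then show "(1 + ln (real N))\<^sup>2 * real N + S \<le> 4 * (real N * (ln (real N))\<^sup>2 + S)"
    using assms(2) by (simp add: power_mult_distrib algebra_simps)
qed

theorem theorem2p1:
  fixes M :: nat and \<mu> :: "real measure" and \<eta> \<epsilon> :: real and a \<psi> :: "nat \<Rightarrow> real"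
  assumes "M \<ge> 3"
    and "kaufman_measure M \<mu>"
    and "\<eta> > 0" and "fourier_decay \<mu> \<eta>"
    and "\<And>n. n \<ge> 1 \<Longrightarrow> \<psi> n \<ge> 0"
    and "inj_on a {1..}"
    and "\<exists>C>0. \<forall>u v. 1 \<le> u \<and> u < v \<longrightarrow>
           (\<Sum>n=u..v. \<Sum>m\<in>{u..v} - {n}. \<bar>a n - a m\<bar> powr (- \<eta>))
             \<le> C * (1 / ln (real v) * (\<Sum>n=u..v. \<psi> n))"
    and "\<epsilon> > 0"
  shows "AE x in \<mu>. x \<in> {0..1} \<longrightarrow>
           (\<exists>C>0. \<forall>N\<ge>3.
              discrepancy N (\<lambda>n. a n * x)
                \<le> C * ((real N * (ln (real N))\<^sup>2 + (\<Sum>n=1..N. \<psi> n)) powr (1 / 2)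
                         * ln (real N * (ln (real N))\<^sup>2 + (\<Sum>n=1..N. \<psi> n)) powr (3 / 2 + \<epsilon>)
                       + Max (\<psi> ` {1..N})))"
proof -
  have \<mu>: "prob_space \<mu>" "sets \<mu> = sets borel"
    using assms(2) by (auto simp: kaufman_measure_def)
  obtain C0 where C0: "C0 > 0" "\<And>u v. 1 \<le> u \<Longrightarrow> u < v \<Longrightarrow>
           (\<Sum>n=u..v. \<Sum>m\<in>{u..v} - {n}. \<bar>a n - a m\<bar> powr (- \<eta>))
             \<le> C0 * (1 / ln (real v) * (\<Sum>n=u..v. \<psi> n))"
    using assms(7) by auto
  obtain C1 where C1: "C1 > 0"
    "\<And>u v. 1 \<le> u \<Longrightarrow> u \<le> v \<Longrightarrow> integrable \<mu> (\<lambda>x. (weyl_bound a u v x)\<^sup>2)"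
    "\<And>u v. 1 \<le> u \<Longrightarrow> u \<le> v \<Longrightarrow> (LINT x|\<mu>. (weyl_bound a u v x)\<^sup>2)
        \<le> C1 * ((1 + ln (real v))\<^sup>2 * real (card {u..v}) + (\<Sum>n=u..v. \<psi> n))"
    using weyl_bound_second_moment[OF \<mu> assms(3-6) C0] by blast
  define \<Phi> where "\<Phi> = (\<lambda>N. real N * (ln (real N))\<^sup>2 + (\<Sum>n=1..N. \<psi> n))"
  have \<psi>_sum: "(\<Sum>n=1..N. \<psi> n) \<ge> 0" for N
    using assms(5) by (intro sum_nonneg) auto
  have \<Phi>: "real N \<le> \<Phi> N" "(1 + ln (real N))\<^sup>2 * real N + (\<Sum>n=1..N. \<psi> n) \<le> 4 * \<Phi> N" if "N \<ge> 3" for N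
    unfolding \<Phi>_def using le_mult_ln_sq_add[OF that \<psi>_sum] by auto
  \<comment> \<open>Level \<open>j\<close> collects the \<open>N\<close> with \<open>\<Phi> N < 2 ^ (j + 1)\<close>; cutting by the size of \<open>\<Phi>\<close> rather than
    of \<open>N\<close> keeps the sums of \<open>\<psi>\<close> under control even when \<open>\<psi>\<close> grows irregularly.\<close>
  define A where "A = (\<lambda>j::nat. {N. 3 \<le> N \<and> \<Phi> N < 2 ^ (j + 1)})"
  have A_less: "N < 2 ^ (j + 1)" if "N \<in> A j" for N j
  proof -
    have "real N < real (2 ^ (j + 1))" using that \<Phi>(1)[of N] by (simp add: A_def)
    then show ?thesis by (simp only: of_nat_less_iff)
  qed
  have A_fin: "finite (A j)" for j
    by (rule finite_subset[of _ "{..<2 ^ (j + 1)}"]) (auto dest: A_less)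
  \<comment> \<open>The largest element of a level controls all the others. An empty level gets 0,
    since \<open>Max {}\<close> is unspecified.\<close>
  define X where "X = (\<lambda>j x. if A j = {} then 0 else dyadic_square_sum a (j + 1) (Max (A j)) x)"
  \<comment> \<open>The moment of level \<open>j\<close> is of order \<open>(j + 1) * 2 ^ j\<close>;
    dividing by \<open>w j\<close> leaves the summable
    \<open>(j + 1) powr (- 1 - 2 * \<epsilon>)\<close>. The factor \<open>j + 1\<close> from the
    dyadic decomposition later raises the power to \<open>3 + 2 * \<epsilon>\<close>, whose square
    root is the exponent in the theorem.\<close>
  define w where "w = (\<lambda>j::nat. real (j + 1) powr (2 + 2 * \<epsilon>) * 2 ^ j)"
  have w0: "w j > 0" for j by (simp add: w_def)
  have X_int: "integrable \<mu> (X j)" for j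
    using dyadic_square_sum_integral(1)[OF assms(5) less_imp_le[OF C1(1)] C1(2,3)]
    by (cases "A j = {}") (auto simp: X_def)
  \<comment> \<open>The 8 is the 4 in the bound by \<open>4 * \<Phi> N\<close> times the 2 in
    \<open>\<Phi> N < 2 ^ (j + 1)\<close>.\<close>
  have X_le: "(LINT x|\<mu>. X j x) \<le> real (j + 1) * (8 * C1 * 2 ^ j)" for j
  proof (cases "A j = {}")
    case False
    define N where "N = Max (A j)"
    have N: "N \<in> A j" unfolding N_def using False A_fin by (rule Max_in[rotated])
    then have N3: "N \<ge> 3" "\<Phi> N \<le> 2 ^ (j + 1)" by (auto simp: A_def)
    have "(LINT x|\<mu>. X j x) = (LINT x|\<mu>. dyadic_square_sum a (j + 1) N x)"
      using False by (simp add: X_def N_def)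
    also have "\<dots> \<le> real (j + 1) * (C1 * ((1 + ln (real N))\<^sup>2 * real N + (\<Sum>n=1..N. \<psi> n)))"
      by (rule dyadic_square_sum_integral(2)[OF assms(5) less_imp_le[OF C1(1)] C1(2,3)])
    also have "\<dots> \<le> real (j + 1) * (C1 * (4 * 2 ^ (j + 1)))"
      using \<Phi>(2)[OF N3(1)] N3(2) C1(1) by (intro mult_left_mono) auto
    finally show ?thesis by simp
  qed (use C1(1) in \<open>simp add: X_def\<close>)

  \<comment> \<open>Almost sure boundedness over all levels\<close>
  have "AE x in \<mu>. \<exists>C\<ge>0. \<forall>j. X j x / w j \<le> C"
  proof (rule AE_bounded_of_summable_integrals)
    show "integrable \<mu> (\<lambda>x. X j x / w j)" for j
      by (intro integrable_divide) (auto intro: X_int)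
    show "0 \<le> X j x / w j" for j x
      using w0[of j] dyadic_square_sum_nonneg by (simp add: X_def)
    show "(LINT x|\<mu>. X j x / w j) \<le> 8 * C1 * real (j + 1) powr (- 1 - 2 * \<epsilon>)" for j
    proof -
      have "real (j + 1) powr (- 1 - 2 * \<epsilon>) * real (j + 1) powr (2 + 2 * \<epsilon>) = real (j + 1) powr 1"
        unfolding powr_add[symmetric] by simp
      then have eq: "real (j + 1) * (8 * C1 * 2 ^ j) = 8 * C1 * real (j + 1) powr (- 1 - 2 * \<epsilon>) * w j"
        by (simp add: w_def)
      have "(LINT x|\<mu>. X j x) / w j \<le> 8 * C1 * real (j + 1) powr (- 1 - 2 * \<epsilon>)"
        unfolding pos_divide_le_eq[OF w0] using X_le[of j] by (simp only: eq)
      then show ?thesis by simp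
    qed
    have "summable (\<lambda>j. real j powr (- 1 - 2 * \<epsilon>))"
      using assms(8) by (simp add: summable_real_powr_iff)
    then show "summable (\<lambda>j. 8 * C1 * real (j + 1) powr (- 1 - 2 * \<epsilon>))"
      using summable_iff_shift[of "\<lambda>j. real j powr (- 1 - 2 * \<epsilon>)" 1] by (intro summable_mult) simp
  qed
  then show ?thesis
  proof eventually_elim
    case (elim x)
    then obtain C where C: "C \<ge> 0" "\<And>j. X j x / w j \<le> C" by blast
    \<comment> \<open>The base 3 comes from \<open>j + 1 \<le> 3 * l\<close>; adding 1 keeps the
      constant positive when \<open>C = 0\<close>.\<close>
    define C' where "C' = sqrt C * 3 powr (3 / 2 + \<epsilon>) + 1"
    have "discrepancy N (\<lambda>n. a n * x) \<le> C' * (\<Phi> N powr (1 / 2) * ln (\<Phi> N) powr (3 / 2 + \<epsilon>) + Max (\<psi> ` {1..N}))"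
      if N: "N \<ge> 3" for N
    proof -
      have \<Phi>3: "\<Phi> N \<ge> 3" using \<Phi>(1)[OF N] N by linarith
      define l where "l = ln (\<Phi> N)"
      have "exp 1 \<le> \<Phi> N" using exp_le \<Phi>3 by linarith
      then have l: "1 \<le> l" using \<Phi>3 by (simp add: l_def ln_ge_iff)
      \<comment> \<open>This is the exact scale of \<open>\<Phi> N\<close>. The upper bound puts
        \<open>N\<close> into \<open>A j\<close>; the lower bound allows the return from
        \<open>2 ^ j\<close> to \<open>\<Phi> N\<close>.\<close>
      define j where "j = nat \<lfloor>log 2 (\<Phi> N)\<rfloor>"
      have lg: "0 \<le> log 2 (\<Phi> N)" using \<Phi>3 by simp
      have j: "real j \<le> log 2 (\<Phi> N)" "log 2 (\<Phi> N) < real (j + 1)"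
        using lg unfolding j_def by linarith+
      have "2 powr real j \<le> \<Phi> N" "\<Phi> N < 2 powr real (j + 1)"
        using j \<Phi>3 by (simp_all only: le_log_iff log_less_iff)
      then have 2: "2 ^ j \<le> \<Phi> N" "\<Phi> N < 2 ^ (j + 1)"
        by (simp_all only: powr_realpow) 
      have NA: "N \<in> A j" using N 2 by (simp add: A_def)
      have Max: "N \<le> Max (A j)" "Max (A j) < 2 ^ (j + 1)"
        using NA A_fin[of j] A_less[OF Max_in[OF A_fin]] by auto
      have "2 * log 2 (\<Phi> N) * (1 / 2) \<le> 2 * l"
      proof -
        have "log 2 (\<Phi> N) * ln 2 = l" using log_def[of 2 "\<Phi> N"] by (simp add: l_def)
        moreover have "log 2 (\<Phi> N) * (1 / 2) \<le> log 2 (\<Phi> N) * ln 2"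
          using lg ln2_ge_two_thirds by (intro mult_left_mono) auto
        ultimately show ?thesis by linarith
      qed
      then have j3: "real (j + 1) \<le> 3 * l" using j(1) l by simp
      \<comment> \<open>The bound is uniform in \<open>I\<close>, so it passes to the supremum over
        all intervals.\<close>
      have dev: "\<bar>count_deviation (\<lambda>n. a n * x) I {1..N}\<bar> \<le> sqrt C * 3 powr (3 / 2 + \<epsilon>) * (\<Phi> N powr (1 / 2) * l powr (3 / 2 + \<epsilon>))"
        if I: "is_interval I" "I \<subseteq> {0..1}" for I
      proof -
        have "(count_deviation (\<lambda>n. a n * x) I {1..N})\<^sup>2 \<le> real (j + 1) * X j x"
          using count_deviation_sq_le[OF I Max, of a x] NA by (auto simp: X_def)
        also have "\<dots> \<le> real (j + 1) * (C * w j)"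
          using C(2)[of j] w0[of j] by (intro mult_left_mono) (auto simp: divide_le_eq)
        also have "\<dots> = C * (real (j + 1) powr (3 + 2 * \<epsilon>) * 2 ^ j)"
          using powr_add[of "real (j + 1)" 1 "2 + 2 * \<epsilon>"] by (simp add: w_def)
        also have "\<dots> \<le> C * ((3 * l) powr (3 + 2 * \<epsilon>) * \<Phi> N)"
          using C(1) j3 2 assms(8) by (intro mult_left_mono mult_mono powr_mono2) auto
        also have "\<dots> = (sqrt C * 3 powr (3 / 2 + \<epsilon>) * (\<Phi> N powr (1 / 2) * l powr (3 / 2 + \<epsilon>)))\<^sup>2"
        proof -
          have sq: "(y powr (p / 2))\<^sup>2 = y powr p" for y p :: real
            by (simp add: power2_eq_square powr_add[symmetric])
          have half: "3 / 2 + \<epsilon> = (3 + 2 * \<epsilon>) / 2" by simp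
          show ?thesis
            unfolding power_mult_distrib half sq using C(1) \<Phi>3 l by (simp add: powr_mult)
        qed
        finally have "\<bar>count_deviation (\<lambda>n. a n * x) I {1..N}\<bar>\<^sup>2
          \<le> (sqrt C * 3 powr (3 / 2 + \<epsilon>) * (\<Phi> N powr (1 / 2) * l powr (3 / 2 + \<epsilon>)))\<^sup>2"
          by (simp only: power2_abs)
        then show ?thesis
          by (rule power2_le_imp_le) (use C(1) in auto)
      qed
      have "discrepancy N (\<lambda>n. a n * x) \<le> sqrt C * 3 powr (3 / 2 + \<epsilon>) * (\<Phi> N powr (1 / 2) * l powr (3 / 2 + \<epsilon>))"
        unfolding discrepancy_def
      proof (rule cSUP_least)
        have "{} \<in> {I. is_interval I \<and> I \<subseteq> {0..1::real}}" by simp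
        then show "{I. is_interval I \<and> I \<subseteq> {0..1::real}} \<noteq> {}" by blast
      next
        fix I :: "real set"
        assume "I \<in> {I. is_interval I \<and> I \<subseteq> {0..1}}"
        then show "\<bar>real (card {n \<in> {1..N}. frac (a n * x) \<in> I}) - real N * measure lborel I\<bar>
          \<le> sqrt C * 3 powr (3 / 2 + \<epsilon>) * (\<Phi> N powr (1 / 2) * l powr (3 / 2 + \<epsilon>))"
          using dev[of I] by (simp add: count_deviation_def)
      qed
      also have "\<dots> \<le> C' * (\<Phi> N powr (1 / 2) * l powr (3 / 2 + \<epsilon>) + Max (\<psi> ` {1..N}))"
      proof -
        \<comment> \<open>The maximum dominates \<open>\<psi> 1\<close>, so it is nonnegative and
          may be added.\<close>
        have "\<psi> 1 \<le> Max (\<psi> ` {1..N})" using N by (intro Max_ge) auto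
        then have "0 \<le> Max (\<psi> ` {1..N})" using assms(5)[of 1] by simp
        then show ?thesis
          unfolding C'_def using C(1) by (intro mult_mono) auto
      qed
      finally show ?thesis by (simp add: l_def)
    qed
    moreover have "C' > 0" unfolding C'_def using C(1) by (intro add_nonneg_pos) auto
    ultimately show ?case unfolding \<Phi>_def by blast
  qed
qed

end
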